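(* Let $M\subset B(H)$ be a von Neumann algebra admitting a cyclic vector, and let $M'$ be its commutant. Let $y_1,\ldots,y_n\in M'$ be such that for all $x_1,\ldots,x_n\in M$, \[\Big\|\sum_{i=1}^n x_iy_i\Big\|\le \max\Big\{\Big\|\sum_i x_i^*x_i\Big\|^{1/2},\Big\|\sum_i x_ix_i^*\Big\|^{1/2}\Big\}.\] Then there is a decomposition $y_i=a_i+b_i$ ($i=1,\ldots,n$) with $a_i,b_i\in M'$ such that $\|\sum_i a_ia_i^*\|\le 1$ and $\|\sum_i b_i^*b_i\|\le 1$. *)

theory Defs
  imports "HOL-Analysis.Analysis"
begin

class complex_hilbert = real_normed_vector + complete_space +
  fixes scaleC :: "complex \<Rightarrow> 'a \<Rightarrow> 'a"
    and cinner :: "'a \<Rightarrow> 'a \<Rightarrow> complex"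
  assumes scaleC_add_right: "scaleC a (x + y) = scaleC a x + scaleC a y"
    and scaleC_add_left: "scaleC (a + b) x = scaleC a x + scaleC b x"
    and scaleC_scaleC: "scaleC a (scaleC b x) = scaleC (a * b) x"
    and scaleC_one: "scaleC 1 x = x"
    and scaleR_scaleC: "scaleR r x = scaleC (complex_of_real r) x"
    and cinner_commute: "cinner x y = cnj (cinner y x)"
    and cinner_add_left: "cinner (x + y) z = cinner x z + cinner y z"
    and cinner_scaleC_left: "cinner (scaleC a x) y = cnj a * cinner x y"
    and cinner_self_nonneg: "0 \<le> Re (cinner x x)"
    and norm_eq_sqrt_cinner: "norm x = sqrt (Re (cinner x x))"

instantiation complex :: complex_hilbert
begin
definition scaleC_complex :: "complex \<Rightarrow> complex \<Rightarrow> complex" where "scaleC_complex a x = a * x"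
definition cinner_complex :: "complex \<Rightarrow> complex \<Rightarrow> complex" where "cinner_complex x y = cnj x * y"
instance
  apply standard
  apply (auto simp: scaleC_complex_def cinner_complex_def algebra_simps scaleR_conv_of_real)
  apply (simp add: cmod_def power2_eq_square add.commute)
  done
end

definition bop :: "('a::complex_hilbert \<Rightarrow> 'a) \<Rightarrow> bool" where
  "bop T \<longleftrightarrow> bounded_linear T \<and> (\<forall>c x. T (scaleC c x) = scaleC c (T x))"

definition adj :: "('a::complex_hilbert \<Rightarrow> 'a) \<Rightarrow> ('a \<Rightarrow> 'a)" where
  "adj T = (SOME S. bop S \<and> (\<forall>x y. cinner (T x) y = cinner x (S y)))"

definition commutant :: "('a::complex_hilbert \<Rightarrow> 'a) set \<Rightarrow> ('a \<Rightarrow> 'a) set" where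
  "commutant S = {T. bop T \<and> (\<forall>A\<in>S. T \<circ> A = A \<circ> T)}"

text \<open>Von Neumann algebra: a self-adjoint set of bounded operators equal to its bicommutant
  (von Neumann's bicommutant characterisation).\<close>
definition von_neumann_algebra :: "('a::complex_hilbert \<Rightarrow> 'a) set \<Rightarrow> bool" where
  "von_neumann_algebra M \<longleftrightarrow> M \<subseteq> Collect bop \<and> (\<forall>A\<in>M. adj A \<in> M) \<and> commutant (commutant M) = M"

definition cyclic_vector :: "('a::complex_hilbert \<Rightarrow> 'a) set \<Rightarrow> 'a \<Rightarrow> bool" where
  "cyclic_vector M \<xi> \<longleftrightarrow> closure {A \<xi> | A. A \<in> M} = UNIV"

end

theory Submission
  imports Defs "HOL-Library.Function_Algebras"
begin

text \<open>Let \<open>\<xi>\<close> be cyclic for \<open>M\<close>. A pair of tuples \<open>X, Y\<close> in \<open>M\<close> is measured by positive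
  \<open>K, K' \<in> M\<close> such that \<open>K'\<^sup>-\<^sup>1\<^sup>/\<^sup>2 X K\<^sup>-\<^sup>1\<^sup>/\<^sup>2\<close> is a column contraction and
  \<open>K'\<^sup>-\<^sup>1\<^sup>/\<^sup>2 Y K\<^sup>-\<^sup>1\<^sup>/\<^sup>2\<close> a row contraction; this is a convex condition on
  \<open>(X, Y, K, K')\<close>. When \<open>X = Y\<close>, the hypothesis applied to \<open>K'\<^sup>-\<^sup>1\<^sup>/\<^sup>2 X K\<^sup>-\<^sup>1\<^sup>/\<^sup>2\<close> bounds
  \<open>Re \<langle>\<xi>, \<Sum> X\<^sub>i y\<^sub>i \<xi>\<rangle>\<close> by half of \<open>\<langle>\<xi>, K \<xi>\<rangle> + \<langle>\<xi>, K' \<xi>\<rangle>\<close>, so Hahn-Banach yields a real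
  linear \<open>G\<close> with \<open>G X - G Y + Re \<langle>\<xi>, \<Sum> Y\<^sub>i y\<^sub>i \<xi>\<rangle>\<close> bounded in the same way for all pairs.
  Bounding \<open>G\<close> on \<open>X\<^sub>i = m\<^sup>* x\<^sub>i\<close> makes it a bounded form on the dense subspace \<open>M \<xi>\<close>, whence
  \<open>G X = Re \<langle>\<xi>, \<Sum> a\<^sub>i X\<^sub>i \<xi>\<rangle>\<close> with \<open>a\<^sub>i\<close> in the commutant forming a row contraction; the
  bound for \<open>Y\<close> says that \<open>b\<^sub>i = y\<^sub>i - a\<^sub>i\<close> form a column contraction.\<close>

section \<open>Separation by cones, extension from dense subspaces\<close>

instantiation "fun" :: (type, real_vector) real_vector
begin
definition scaleR_fun :: "real \<Rightarrow> ('a \<Rightarrow> 'b) \<Rightarrow> 'a \<Rightarrow> 'b"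
  where "scaleR_fun r f = (\<lambda>x. r *\<^sub>R f x)"
instance
  by standard (auto simp: scaleR_fun_def fun_eq_iff scaleR_add_right scaleR_add_left)
end

lemma scaleR_fun_apply [simp]: "(r *\<^sub>R f) x = r *\<^sub>R f x"
  by (simp add: scaleR_fun_def)

text \<open>A maximal cone \<open>E\<close> still satisfying \<open>pos\<close> contains a line through each \<open>(v, t)\<close> with
  \<open>t = inf {r. (v, r) \<in> E}\<close>; these lines form the graph of \<open>G\<close>.\<close>

lemma cone_Hahn_Banach:
  fixes E0 :: "('v::real_vector \<times> real) set" and S :: "'v set"
  assumes zero: "0 \<in> E0"
    and add: "\<And>p q. p \<in> E0 \<Longrightarrow> q \<in> E0 \<Longrightarrow> p + q \<in> E0"
    and scale: "\<And>c p. c > 0 \<Longrightarrow> p \<in> E0 \<Longrightarrow> c *\<^sub>R p \<in> E0"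
    and pos: "\<And>r. (0, r) \<in> E0 \<Longrightarrow> 0 \<le> r"
    and dom: "\<And>v. v \<in> S \<Longrightarrow> \<exists>r. (v, r) \<in> E0"
    and sub: "subspace S"
  obtains G :: "'v \<Rightarrow> real" where
    "\<And>v w. v \<in> S \<Longrightarrow> w \<in> S \<Longrightarrow> G (v + w) = G v + G w"
    "\<And>c v. v \<in> S \<Longrightarrow> G (c *\<^sub>R v) = c * G v"
    "\<And>v r. v \<in> S \<Longrightarrow> (v, r) \<in> E0 \<Longrightarrow> G v \<le> r"
proof -
  define good where "good E \<longleftrightarrow> E0 \<subseteq> E \<and> (\<forall>p\<in>E. \<forall>q\<in>E. p + q \<in> E) \<and>
      (\<forall>c>0. \<forall>p\<in>E. c *\<^sub>R p \<in> E) \<and> (\<forall>r. (0, r) \<in> E \<longrightarrow> 0 \<le> r)" for E :: "('v \<times> real) set"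
  have good0: "good E0"
    unfolding good_def using add scale pos by blast
  have "\<exists>E\<in>Collect good. \<forall>X\<in>Collect good. E \<subseteq> X \<longrightarrow> X = E"
  proof (rule subset_Zorn_nonempty)
    show "Collect good \<noteq> {}" using good0 by blast
  next
    fix C assume ne: "C \<noteq> {}" and ch: "subset.chain (Collect good) C"
    have g: "good X" if "X \<in> C" for X
      using ch that by (auto simp: subset.chain_def)
    have "p + q \<in> \<Union>C" if "p \<in> X" "q \<in> Y" "X \<in> C" "Y \<in> C" for p q X Y
    proof -
      have "X \<subseteq> Y \<or> Y \<subseteq> X"
        using ch that by (auto simp: subset.chain_def)
      then show ?thesis using g that unfolding good_def by (meson UnionI subsetD)
    qed
    then have "\<forall>p\<in>\<Union>C. \<forall>q\<in>\<Union>C. p + q \<in> \<Union>C" by blast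
    moreover have "E0 \<subseteq> \<Union>C" using g ne unfolding good_def by blast
    moreover have "\<forall>c>0. \<forall>p\<in>\<Union>C. c *\<^sub>R p \<in> \<Union>C"
      using g unfolding good_def by (meson UnionE UnionI)
    moreover have "\<forall>r. (0, r) \<in> \<Union>C \<longrightarrow> 0 \<le> r"
      using g unfolding good_def by (meson UnionE)
    ultimately show "\<Union>C \<in> Collect good"
      unfolding good_def mem_Collect_eq by (intro conjI)
  qed
  then obtain E where E: "good E" and maxE: "\<And>X. good X \<Longrightarrow> E \<subseteq> X \<Longrightarrow> X = E"
    by blast
  have E0: "E0 \<subseteq> E" and Eadd: "\<And>p q. p \<in> E \<Longrightarrow> q \<in> E \<Longrightarrow> p + q \<in> E"
    and Escale: "\<And>c p. c > 0 \<Longrightarrow> p \<in> E \<Longrightarrow> c *\<^sub>R p \<in> E"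
    and Epos: "\<And>r. (0, r) \<in> E \<Longrightarrow> 0 \<le> r"
    using E unfolding good_def by blast+
  have line: "\<exists>t. (v, t) \<in> E \<and> (- v, - t) \<in> E" if v: "v \<in> S" for v
  proof -
    define t where "t = Inf {r. (v, r) \<in> E}"
    have ne: "{r. (v, r) \<in> E} \<noteq> {}" using dom v E0 by blast
    have sum0: "0 \<le> r + r'" if "(v, r) \<in> E" "(- v, r') \<in> E" for r r'
      using Eadd [OF that] Epos by simp
    obtain r0 where r0: "(- v, r0) \<in> E"
      using dom [of "- v"] subspace_neg [OF sub v] E0 by blast
    have bdd: "bdd_below {r. (v, r) \<in> E}"
      using sum0 r0 by (intro bdd_belowI [of _ "- r0"]) force
    have t1: "t \<le> r" if "(v, r) \<in> E" for r
      unfolding t_def using that bdd by (intro cInf_lower) auto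
    have t2: "- r \<le> t" if "(- v, r) \<in> E" for r
      unfolding t_def using that ne sum0 by (intro cInf_greatest) force+
    define X where "X = {p + s *\<^sub>R (v, t) | p s. p \<in> E}"
    have EX: "E \<subseteq> X"
    proof
      fix p assume "p \<in> E" then show "p \<in> X"
        unfolding X_def by (intro CollectI exI [of _ p] exI [of _ 0]) (auto simp: zero_prod_def)
    qed
    have Xpos: "0 \<le> r" if "(0, r) \<in> X" for r
    proof -
      obtain w q s where p: "(w, q) \<in> E" "0 = w + s *\<^sub>R v" "r = q + s * t"
        using \<open>(0, r) \<in> X\<close> unfolding X_def by auto
      have w: "w = (- s) *\<^sub>R v" using p(2) by (simp add: eq_neg_iff_add_eq_0)
      consider "s = 0" | "s > 0" | "s < 0" by linarith
      then show ?thesis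
      proof cases
        case 1 then show ?thesis using p w Epos by simp
      next
        case 2
        then have "(- v, q / s) \<in> E"
          using Escale [of "1/s", OF _ p(1)] w by simp
        then show ?thesis using t2 [of "q/s"] 2 p(3) by (simp add: field_simps)
      next
        case 3
        then have "(v, q / (- s)) \<in> E"
          using Escale [of "1/(- s)", OF _ p(1)] w by simp
        then show ?thesis using t1 [of "q/(- s)"] 3 p(3) by (simp add: field_simps)
      qed
    qed
    have Xadd: "p + q \<in> X" if pX: "p \<in> X" and qX: "q \<in> X" for p q
    proof -
      obtain p' s where 1: "p = p' + s *\<^sub>R (v, t)" "p' \<in> E" using pX unfolding X_def by blast
      obtain q' s' where 2: "q = q' + s' *\<^sub>R (v, t)" "q' \<in> E" using qX unfolding X_def by blast
      have "p + q = (p' + q') + (s + s') *\<^sub>R (v, t)"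
        using 1 2 by (simp only: scaleR_add_left add_ac)
      then show ?thesis unfolding X_def using Eadd 1 2 by blast
    qed
    have Xscale: "c *\<^sub>R p \<in> X" if c: "c > 0" and pX: "p \<in> X" for c p
    proof -
      obtain p' s where 1: "p = p' + s *\<^sub>R (v, t)" "p' \<in> E" using pX unfolding X_def by blast
      have "c *\<^sub>R p = c *\<^sub>R p' + (c * s) *\<^sub>R (v, t)"
        using 1 by (simp only: scaleR_add_right scaleR_scaleR)
      then show ?thesis unfolding X_def using Escale c 1 by blast
    qed
    have "X = E"
      using EX E0 Xpos Xadd Xscale by (intro maxE) (auto simp: good_def)
    moreover have z: "0 \<in> E" using zero E0 by blast
    have "0 + 1 *\<^sub>R (v, t) \<in> X" "0 + (-1) *\<^sub>R (v, t) \<in> X"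
      unfolding X_def using z by blast+
    ultimately show ?thesis by (auto simp: zero_prod_def)
  qed
  define G where "G v = (SOME t. (v, t) \<in> E \<and> (- v, - t) \<in> E)" for v
  have G: "(v, G v) \<in> E \<and> (- v, - G v) \<in> E" if "v \<in> S" for v
    unfolding G_def using line [OF that] by (rule someI_ex)
  have le: "G v \<le> r" if "v \<in> S" "(v, r) \<in> E" for v r
    using Eadd [OF that(2), of "(- v, - G v)"] G [OF that(1)] Epos [of "r - G v"] by simp
  have ge: "- r \<le> G v" if "v \<in> S" "(- v, r) \<in> E" for v r
    using Eadd [OF that(2), of "(v, G v)"] G [OF that(1)] Epos [of "r + G v"] by simp
  have Gadd: "G (v + w) = G v + G w" if "v \<in> S" "w \<in> S" for v w
  proof (rule antisym)
    have "v + w \<in> S" using that sub by (simp add: subspace_add)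
    then show "G (v + w) \<le> G v + G w" "G v + G w \<le> G (v + w)"
      using le [of "v + w" "G v + G w"] ge [of "v + w" "- G v - G w"]
        Eadd [of "(v, G v)" "(w, G w)"] Eadd [of "(- v, - G v)" "(- w, - G w)"]
        G [OF that(1)] G [OF that(2)] by (auto simp: algebra_simps)
  qed
  have Gpos: "G (c *\<^sub>R v) = c * G v" if "v \<in> S" "c > 0" for v c
  proof (rule antisym)
    have "c *\<^sub>R v \<in> S" using that sub by (simp add: subspace_scale)
    then show "G (c *\<^sub>R v) \<le> c * G v" "c * G v \<le> G (c *\<^sub>R v)"
      using le [of "c *\<^sub>R v" "c * G v"] ge [of "c *\<^sub>R v" "- c * G v"]
        Escale [OF that(2), of "(v, G v)"] Escale [OF that(2), of "(- v, - G v)"]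
        G [OF that(1)] by auto
  qed
  have G0: "G 0 = 0"
    using Gadd [of 0 0] subspace_0 [OF sub] by simp
  have Gneg: "G (- v) = - G v" if "v \<in> S" for v
    using Gadd [of v "- v"] that subspace_neg [OF sub that] G0 by simp
  have "G (c *\<^sub>R v) = c * G v" if "v \<in> S" for c v
  proof -
    consider "c = 0" | "c > 0" | "c < 0" by linarith
    then show ?thesis
    proof cases
      case 1 then show ?thesis using G0 by simp
    next
      case 2 then show ?thesis using Gpos that by simp
    next
      case 3
      have "G (- ((- c) *\<^sub>R v)) = - ((- c) * G v)"
        using 3 Gpos [OF that, of "- c"] Gneg [OF subspace_scale [OF sub that, of "- c"]]
        by simp
      then show ?thesis by simp
    qed
  qed
  from Gadd this show ?thesis
    by (rule that) (use le E0 in blast)+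
qed

lemma bounded_linear_extension:
  fixes e :: "'v::real_vector \<Rightarrow> 'h::real_normed_vector" and \<phi> :: "'v \<Rightarrow> 'b::banach"
  assumes sub: "subspace M" and dense: "closure (e ` M) = UNIV"
    and e_add: "\<And>x y. x \<in> M \<Longrightarrow> y \<in> M \<Longrightarrow> e (x + y) = e x + e y"
    and e_scale: "\<And>r x. x \<in> M \<Longrightarrow> e (r *\<^sub>R x) = r *\<^sub>R e x"
    and p_add: "\<And>x y. x \<in> M \<Longrightarrow> y \<in> M \<Longrightarrow> \<phi> (x + y) = \<phi> x + \<phi> y"
    and p_scale: "\<And>r x. x \<in> M \<Longrightarrow> \<phi> (r *\<^sub>R x) = r *\<^sub>R \<phi> x"
    and bnd: "\<And>x. x \<in> M \<Longrightarrow> norm (\<phi> x) \<le> C * norm (e x)"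
  obtains T where "bounded_linear T" "\<And>x. x \<in> M \<Longrightarrow> T (e x) = \<phi> x"
proof -
  define D where "D = max C 0"
  have D: "D \<ge> 0" "\<And>x. x \<in> M \<Longrightarrow> norm (\<phi> x) \<le> D * norm (e x)"
    unfolding D_def by (auto intro!: order_trans [OF bnd] mult_right_mono)
  have diff: "norm (\<phi> x - \<phi> y) \<le> D * norm (e x - e y)" if "x \<in> M" "y \<in> M" for x y
  proof -
    have m: "(-1) *\<^sub>R y \<in> M" using that sub by (simp add: subspace_neg)
    have "\<phi> (x + (-1) *\<^sub>R y) = \<phi> x - \<phi> y" "e (x + (-1) *\<^sub>R y) = e x - e y"
      using p_add [OF that(1) m] e_add [OF that(1) m] p_scale [OF that(2), of "-1"] e_scale [OF that(2), of "-1"]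
      by auto
    then show ?thesis using D(2) [of "x + (-1) *\<^sub>R y"] that m sub by (simp add: subspace_diff)
  qed
  define g where "g h = \<phi> (SOME x. x \<in> M \<and> e x = h)" for h
  have g: "g (e x) = \<phi> x" if "x \<in> M" for x
  proof -
    have "(SOME z. z \<in> M \<and> e z = e x) \<in> M \<and> e (SOME z. z \<in> M \<and> e z = e x) = e x"
      by (rule someI [of _ x]) (use that in auto)
    then show ?thesis unfolding g_def using diff [of "SOME z. z \<in> M \<and> e z = e x" x] that by simp
  qed
  have "D-lipschitz_on (e ` M) g"
    using diff g D(1) by (auto simp: lipschitz_on_def dist_norm)
  then have "uniformly_continuous_on (e ` M) g"
    by (rule lipschitz_on_uniformly_continuous)
  then obtain T where uT: "uniformly_continuous_on (closure (e ` M)) T"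
    and T0: "\<And>h. h \<in> e ` M \<Longrightarrow> g h = T h"
    by (rule uniformly_continuous_on_extension_on_closure) blast
  have cT: "continuous_on UNIV T"
    using uT dense uniformly_continuous_imp_continuous by auto
  have T: "T (e x) = \<phi> x" if "x \<in> M" for x
    using T0 [of "e x"] g that by auto
  have dense': "\<exists>f. (\<forall>n::nat. f n \<in> M) \<and> (\<lambda>n. e (f n)) \<longlonglongrightarrow> h" for h
  proof -
    have "h \<in> closure (e ` M)" using dense by simp
    then obtain u where u: "\<forall>n. u n \<in> e ` M" "u \<longlonglongrightarrow> h" unfolding closure_sequential by blast
    then have "\<forall>n. \<exists>x. x \<in> M \<and> u n = e x" by blast
    then obtain f where f: "\<forall>n. f n \<in> M \<and> u n = e (f n)" by metis
    then have "u = (\<lambda>n. e (f n))" by auto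
    with f u(2) show ?thesis by auto
  qed
  have lim: "(\<lambda>n. T (u n)) \<longlonglongrightarrow> T h" if "u \<longlonglongrightarrow> h" for u h
    using continuous_on_tendsto_compose [OF cT that] by simp
  have "bounded_linear T"
  proof (rule bounded_linear_intro)
    fix h k
    obtain f f' where f: "\<forall>n::nat. f n \<in> M" "(\<lambda>n. e (f n)) \<longlonglongrightarrow> h"
      and f': "\<forall>n::nat. f' n \<in> M" "(\<lambda>n. e (f' n)) \<longlonglongrightarrow> k"
      using dense' by metis
    have "(\<lambda>n. T (e (f n) + e (f' n))) \<longlonglongrightarrow> T (h + k)"
      by (intro lim tendsto_add f f')
    moreover have "(\<lambda>n. T (e (f n)) + T (e (f' n))) \<longlonglongrightarrow> T h + T k"
      by (intro tendsto_add lim f f')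
    moreover have "T (e (f n) + e (f' n)) = T (e (f n)) + T (e (f' n))" for n
      using T [of "f n + f' n"] f(1) f'(1) sub by (simp add: T e_add p_add subspace_add)
    ultimately show "T (h + k) = T h + T k"
      by (metis (no_types, lifting) LIMSEQ_unique ext)
  next
    fix r h
    obtain f where f: "\<forall>n::nat. f n \<in> M" "(\<lambda>n. e (f n)) \<longlonglongrightarrow> h" using dense' by metis
    have "(\<lambda>n. T (r *\<^sub>R e (f n))) \<longlonglongrightarrow> T (r *\<^sub>R h)"
      by (intro lim tendsto_scaleR tendsto_const f)
    moreover have "(\<lambda>n. r *\<^sub>R T (e (f n))) \<longlonglongrightarrow> r *\<^sub>R T h"
      by (intro tendsto_scaleR tendsto_const lim f)
    moreover have "T (r *\<^sub>R e (f n)) = r *\<^sub>R T (e (f n))" for n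
      using T [of "r *\<^sub>R f n"] f(1) sub by (simp add: T e_scale p_scale subspace_scale)
    ultimately show "T (r *\<^sub>R h) = r *\<^sub>R T h"
      by (metis (no_types, lifting) LIMSEQ_unique ext)
  next
    fix h
    obtain f where f: "\<forall>n::nat. f n \<in> M" "(\<lambda>n. e (f n)) \<longlonglongrightarrow> h" using dense' by metis
    show "norm (T h) \<le> norm h * D"
      by (rule LIMSEQ_le [OF tendsto_norm [OF lim [OF f(2)]]
            tendsto_mult [OF tendsto_norm [OF f(2)] tendsto_const]])
         (use f(1) T D in \<open>auto simp: mult.commute\<close>)
  qed
  with T that show ?thesis by blast
qed

section \<open>Adjoints\<close>

text \<open>The real part of the inner product makes the space a real Hilbert space and determines
  \<^const>\<open>cinner\<close>; all estimates are made with it.\<close>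

definition rip :: "'a::complex_hilbert \<Rightarrow> 'a \<Rightarrow> real"
  where "rip x y = Re (cinner x y)"

lemma rip_commute: "rip x y = rip y x"
  unfolding rip_def by (subst cinner_commute) simp

lemma rip_add_left: "rip (x + y) z = rip x z + rip y z"
  by (simp add: rip_def cinner_add_left)

lemma rip_scaleR_left: "rip (r *\<^sub>R x) y = r * rip x y"
  by (simp add: rip_def scaleR_scaleC cinner_scaleC_left)

lemma rip_add_right: "rip x (y + z) = rip x y + rip x z"
  using rip_add_left [of y z x] by (simp add: rip_commute)

lemma rip_scaleR_right: "rip x (r *\<^sub>R y) = r * rip x y"
  using rip_scaleR_left [of r y x] by (simp add: rip_commute)

lemma rip_scaleC: "rip (scaleC c x) y = rip x (scaleC (cnj c) y)"
proof -
  have "rip x (scaleC (cnj c) y) = rip (scaleC (cnj c) y) x" by (rule rip_commute)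
  also have "\<dots> = Re (c * cinner y x)" by (simp add: rip_def cinner_scaleC_left)
  also have "c * cinner y x = cnj (cnj c * cinner x y)"
    by (subst cinner_commute [of y]) simp
  finally show ?thesis by (simp add: rip_def cinner_scaleC_left)
qed

lemma power2_norm_eq_rip: "(norm x)\<^sup>2 = rip x x" for x :: "'a::complex_hilbert"
  by (simp add: norm_eq_sqrt_cinner rip_def cinner_self_nonneg)

lemma norm_le_iff_rip: "norm x \<le> norm y \<longleftrightarrow> rip x x \<le> rip y y" for x :: "'a::complex_hilbert"
  by (simp flip: power2_norm_eq_rip)

lemma rip_le_norm: "rip x y \<le> norm x * norm y"
proof (cases "norm x = 0 \<or> norm y = 0")
  case True
  have "rip 0 y = 0" "rip 0 x = 0" using rip_scaleR_left [of 0 0] by auto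
  then show ?thesis using True rip_commute [of x y] by auto
next
  case False
  define a b where "a = norm x" "b = norm y"
  have ab: "a > 0" "b > 0" using False by (auto simp: a_b_def)
  have "0 \<le> rip (b *\<^sub>R x + (- a) *\<^sub>R y) (b *\<^sub>R x + (- a) *\<^sub>R y)" by (simp flip: power2_norm_eq_rip)
  also have "rip (b *\<^sub>R x + (- a) *\<^sub>R y) (b *\<^sub>R x + (- a) *\<^sub>R y)
      = b * (b * rip x x) - 2 * (a * b) * rip x y + a * (a * rip y y)"
    unfolding rip_add_left rip_add_right rip_scaleR_left rip_scaleR_right rip_commute [of y x]
    by (simp add: algebra_simps)
  also have "\<dots> = 2 * (a * b) * (a * b - rip x y)"
    by (simp add: a_b_def power2_eq_square algebra_simps flip: power2_norm_eq_rip)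
  finally have "0 \<le> a * b - rip x y"
    using ab by (metis mult_pos_pos zero_le_mult_iff not_less zero_less_numeral)
  then show ?thesis by (simp add: a_b_def)
qed

lemma bounded_bilinear_rip: "bounded_bilinear rip"
proof
  fix x y z :: 'a and r :: real
  show 1: "rip (x + y) z = rip x z + rip y z" by (rule rip_add_left)
  show 2: "rip (r *\<^sub>R x) y = r *\<^sub>R rip x y" by (simp add: rip_scaleR_left)
  show "rip x (y + z) = rip x y + rip x z"
    by (rule rip_add_right)
  show "rip x (r *\<^sub>R y) = r *\<^sub>R rip x y"
    by (simp add: rip_scaleR_right)
next
  have "norm (rip x y) \<le> norm x * norm y * 1" for x y :: 'a
    using rip_le_norm [of x y] rip_le_norm [of "- x" y] rip_scaleR_left [of "-1" x y] by auto
  then show "\<exists>K. \<forall>a b::'a. norm (rip a b) \<le> norm a * norm b * K" by blast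
qed

interpretation rip: bounded_bilinear "rip :: 'a::complex_hilbert \<Rightarrow> 'a \<Rightarrow> real"
  by (rule bounded_bilinear_rip)

lemma rip_self_ge_0 [simp]: "0 \<le> rip x x"
  by (simp flip: power2_norm_eq_rip)

lemma rip_add_self: "rip (x + y) (x + y) = rip x x + 2 * rip x y + rip y y"
  by (simp add: rip.add_left rip.add_right rip_commute [of y x])

lemma rip_diff_self: "rip (x - y) (x - y) = rip x x - 2 * rip x y + rip y y"
  by (simp add: rip.diff_left rip.diff_right rip_commute [of y x])

lemma two_rip_le: "2 * rip x y \<le> rip x x + rip y y"
  using rip_self_ge_0 [of "x - y"] by (simp add: rip_diff_self)

lemma rip_ext: "(\<And>x. rip x y = rip x z) \<Longrightarrow> y = z"
  using power2_norm_eq_rip [of "y - z"] by (simp add: rip.diff_right)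

instance complex_hilbert \<subseteq> banach ..

text \<open>The minimiser of \<open>norm x ^ 2 - 2 * f x\<close> represents \<open>f\<close>.\<close>

lemma Riesz_rip:
  fixes f :: "'a::complex_hilbert \<Rightarrow> real"
  assumes "bounded_linear f"
  obtains z where "\<And>x. f x = rip z x"
proof -
  interpret f: bounded_linear f by fact
  define g where "g x = rip x x - 2 * f x" for x
  obtain C where C: "C > 0" "\<And>x. norm (f x) \<le> norm x * C" using f.pos_bounded by blast
  have low: "- C\<^sup>2 \<le> g x" for x
  proof -
    have "2 * f x \<le> 2 * norm x * C" using C(2) [of x] by simp
    also have "\<dots> \<le> (norm x)\<^sup>2 + C\<^sup>2" by (rule sum_squares_bound)
    finally show ?thesis by (simp add: g_def power2_norm_eq_rip)
  qed
  then have bdd: "bdd_below (range g)" by (intro bdd_belowI [of _ "- C\<^sup>2"]) auto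
  define m where "m = Inf (range g)"
  have m: "m \<le> g x" for x unfolding m_def using bdd by (intro cInf_lower) auto
  have "\<exists>x. g x < m + 1 / real (Suc k)" for k
  proof -
    have "Inf (range g) < m + 1 / real (Suc k)" unfolding m_def by simp
    then show ?thesis using cInf_lessD [of "range g"] by blast
  qed
  then obtain u where u: "\<And>k. g (u k) < m + 1 / real (Suc k)" by metis
  have par: "(norm (x - y))\<^sup>2 \<le> 2 * (g x - m) + 2 * (g y - m)" for x y
  proof -
    have "4 * g ((1/2) *\<^sub>R (x + y)) = rip (x + y) (x + y) - 4 * f x - 4 * f y"
      unfolding g_def f.scaleR f.add rip.scaleR_left rip.scaleR_right by (simp add: field_simps)
    then have "(norm (x - y))\<^sup>2 = 2 * g x + 2 * g y - 4 * g ((1/2) *\<^sub>R (x + y))"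
      unfolding power2_norm_eq_rip by (simp add: rip_add_self rip_diff_self g_def)
    then show ?thesis using m [of "(1/2) *\<^sub>R (x + y)"] by simp
  qed
  have "Cauchy u"
  proof (rule CauchyI)
    fix e :: real assume e: "e > 0"
    obtain N where N: "4 / e\<^sup>2 < real N" using reals_Archimedean2 by blast
    have small: "g (u k) < m + e\<^sup>2 / 4" if "k \<ge> N" for k
    proof -
      have "4 / e\<^sup>2 < real (Suc k)" using N that by simp
      then have "1 / real (Suc k) < e\<^sup>2 / 4" using e by (simp add: field_simps)
      then show ?thesis using u [of k] by linarith
    qed
    show "\<exists>N. \<forall>p\<ge>N. \<forall>q\<ge>N. norm (u p - u q) < e"
    proof (intro exI [of _ N] allI impI)
      fix p q assume pq: "N \<le> p" "N \<le> q"
      have "(norm (u p - u q))\<^sup>2 < e\<^sup>2"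
        using par [of "u p" "u q"] small [OF pq(1)] small [OF pq(2)] by simp
      then show "norm (u p - u q) < e" using e by (simp add: power2_less_imp_less)
    qed
  qed
  then obtain z where z: "u \<longlonglongrightarrow> z" using Cauchy_convergent convergent_def by blast
  have "(\<lambda>k. g (u k)) \<longlonglongrightarrow> g z"
    unfolding g_def by (intro tendsto_intros rip.tendsto f.tendsto z)
  moreover have "(\<lambda>k. m + 1 / real (Suc k)) \<longlonglongrightarrow> m + 0"
    by (intro tendsto_intros LIMSEQ_Suc [OF lim_1_over_n])
  ultimately have "g z \<le> m + 0"
    by (rule LIMSEQ_le) (use u less_imp_le in blast)
  then have gz: "g z \<le> g x" for x using m [of x] by simp
  have "f x = rip z x" for x
  proof (rule ccontr)
    assume ne: "f x \<noteq> rip z x"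
    define d where "d = f x - rip z x"
    define t where "t = d / (rip x x + 1)"
    have "g (z + t *\<^sub>R x) = g z - 2 * t * d + t * t * rip x x"
      unfolding g_def d_def rip_add_self
      by (simp add: f.add f.scaleR rip.scaleR_left rip.scaleR_right algebra_simps)
    then have "2 * t * d \<le> t * t * rip x x" using gz [of "z + t *\<^sub>R x"] by simp
    also have "\<dots> \<le> t * t * (rip x x + 1)" by (simp add: algebra_simps)
    also have "\<dots> = t * d"
    proof -
      have "t * (rip x x + 1) = d" unfolding t_def using rip_self_ge_0 [of x]
        by (simp add: add_nonneg_eq_0_iff)
      then show ?thesis by (simp add: mult.assoc)
    qed
    finally have "t * d \<le> 0" by (simp add: mult.commute)
    then have "d * d / (rip x x + 1) \<le> 0" by (simp add: t_def)
    moreover have "d * d / (rip x x + 1) > 0"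
      using ne rip_self_ge_0 [of x] by (intro divide_pos_pos) (auto simp: d_def zero_less_mult_iff add_nonneg_pos)
    ultimately show False by simp
  qed
  then show ?thesis by (rule that)
qed

lemma bop_bounded_linear: "bop T \<Longrightarrow> bounded_linear T"
  and bop_scaleC: "bop T \<Longrightarrow> T (scaleC c x) = scaleC c (T x)"
  by (auto simp: bop_def)

lemma bop_add: "bop T \<Longrightarrow> T (x + y) = T x + T y"
  and bop_scaleR: "bop T \<Longrightarrow> T (r *\<^sub>R x) = r *\<^sub>R T x"
  and bop_zero: "bop T \<Longrightarrow> T 0 = 0"
  using bop_bounded_linear [of T] bounded_linear.linear [of T]
  by (simp_all add: linear_add linear_scale linear_0)

lemma cinner_eq_iff_rip:
  assumes "\<And>x. rip (F x) y = rip x w" and "\<And>x. F (scaleC \<i> x) = scaleC \<i> (F x)"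
  shows "cinner (F x) y = cinner x w"
proof (rule complex_eqI)
  show "Re (cinner (F x) y) = Re (cinner x w)" using assms(1) [of x] by (simp add: rip_def)
  have "rip (scaleC \<i> (F x)) y = rip (scaleC \<i> x) w" using assms(1) [of "scaleC \<i> x"] assms(2) by simp
  then show "Im (cinner (F x) y) = Im (cinner x w)" by (simp add: rip_def cinner_scaleC_left)
qed

lemma adjoint_exists:
  assumes T: "bop T"
  shows "\<exists>S. bop S \<and> (\<forall>x y. cinner (T x) y = cinner x (S y))"
proof -
  interpret T: bounded_linear T by (rule bop_bounded_linear [OF T])
  have "\<exists>z. \<forall>x. rip (T x) y = rip z x" for y
    using Riesz_rip [OF bounded_linear_compose [OF rip.bounded_linear_left T.bounded_linear_axioms]] by metis
  then obtain S where "\<And>x y. rip (T x) y = rip (S y) x" by metis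
  then have S: "rip (T x) y = rip x (S y)" for x y by (metis rip_commute)
  obtain C where C: "C > 0" "\<And>x. norm (T x) \<le> norm x * C" using T.pos_bounded by blast
  have "bounded_linear S"
  proof (rule bounded_linear_intro)
    show "S (x + y) = S x + S y" for x y
      by (rule rip_ext) (simp add: rip.add_right flip: S)
    show "S (r *\<^sub>R x) = r *\<^sub>R S x" for r x
      by (rule rip_ext) (simp add: rip.scaleR_right flip: S)
    show "norm (S y) \<le> norm y * C" for y
    proof (cases "S y = 0")
      case False
      have "norm (S y) * norm (S y) = rip (T (S y)) y"
        by (simp add: S flip: power2_norm_eq_rip power2_eq_square)
      also have "\<dots> \<le> norm (T (S y)) * norm y" by (rule rip_le_norm)
      also have "\<dots> \<le> norm (S y) * C * norm y" by (intro mult_right_mono C) simp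
      finally show ?thesis using False by (simp add: mult_ac)
    qed (use C in simp)
  qed
  moreover have "S (scaleC c x) = scaleC c (S x)" for c x
  proof (rule rip_ext)
    fix u
    have "rip u (S (scaleC c x)) = rip (scaleC (cnj c) (T u)) x"
      by (simp add: rip_scaleC flip: S)
    also have "\<dots> = rip u (scaleC c (S x))"
      using S [of "scaleC (cnj c) u" x] bop_scaleC [OF T] by (simp add: rip_scaleC)
    finally show "rip u (S (scaleC c x)) = rip u (scaleC c (S x))" .
  qed
  ultimately have "bop S" by (simp add: bop_def)
  moreover have "cinner (T x) y = cinner x (S y)" for x y
    by (rule cinner_eq_iff_rip) (use S bop_scaleC [OF T] in auto)
  ultimately show ?thesis by blast
qed

lemma
  assumes "bop T"
  shows bop_adj: "bop (adj T)" and rip_adj: "rip (T x) y = rip x (adj T y)"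
proof -
  have "bop (adj T) \<and> (\<forall>x y. cinner (T x) y = cinner x (adj T y))"
    unfolding adj_def by (rule someI_ex [OF adjoint_exists [OF assms]])
  then show "bop (adj T)" "rip (T x) y = rip x (adj T y)"
    unfolding rip_def by metis+
qed

lemma rip_adj_left: "bop T \<Longrightarrow> rip (adj T x) y = rip x (T y)"
  by (metis rip_adj rip_commute)

lemma adj_unique: "bop T \<Longrightarrow> (\<And>x y. rip (T x) y = rip x (S y)) \<Longrightarrow> adj T = S"
  by (intro ext rip_ext) (metis rip_adj)

lemma adj_adj: "bop T \<Longrightarrow> adj (adj T) = T"
  by (intro adj_unique bop_adj) (simp_all add: rip_adj_left)

lemma bop_comp: "bop S \<Longrightarrow> bop T \<Longrightarrow> bop (S \<circ> T)"
  by (auto simp: bop_def o_def intro: bounded_linear_compose)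

lemma adj_comp: "bop S \<Longrightarrow> bop T \<Longrightarrow> adj (S \<circ> T) = adj T \<circ> adj S"
  by (intro adj_unique bop_comp) (simp_all add: rip_adj)

lemma bop_plus: "bop S \<Longrightarrow> bop T \<Longrightarrow> bop (S + T)"
  by (auto simp: bop_def plus_fun_def scaleC_add_right intro: bounded_linear_add)

lemma bop_scaleR_fun: "bop T \<Longrightarrow> bop (r *\<^sub>R T)"
  using bounded_linear_compose [OF bounded_linear_scaleR_right [of r], of T]
  by (auto simp: bop_def scaleR_fun_def scaleR_scaleC scaleC_scaleC mult.commute)

lemma bop_id: "bop (id :: 'a::complex_hilbert \<Rightarrow> 'a)"
  by (simp add: bop_def id_def bounded_linear_ident)

lemma adj_plus: "bop S \<Longrightarrow> bop T \<Longrightarrow> adj (S + T) = adj S + adj T"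
  by (intro adj_unique bop_plus) (simp_all add: rip.add_left rip.add_right rip_adj)

lemma adj_scaleR: "bop T \<Longrightarrow> adj (r *\<^sub>R T) = r *\<^sub>R adj T"
  by (intro adj_unique bop_scaleR_fun) (simp_all add: rip.scaleR_left rip.scaleR_right rip_adj)

lemma adj_zero: "adj 0 = 0"
  using adj_scaleR [OF bop_id, of 0] by simp

lemma onorm_sum_adj_le_1:
  assumes w: "\<And>i. i \<in> A \<Longrightarrow> bop (w i)"
    and col: "\<And>h. (\<Sum>i\<in>A. rip (w i h) (w i h)) \<le> rip h h"
  shows "onorm (\<lambda>v. \<Sum>i\<in>A. adj (w i) (w i v)) \<le> 1"
proof (rule onorm_bound)
  fix v
  define u where "u = (\<Sum>i\<in>A. adj (w i) (w i v))"
  have "rip u u = (\<Sum>i\<in>A. rip (w i v) (w i u))"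
    by (subst u_def) (simp add: rip.sum_left w rip_adj_left)
  then have "2 * rip u u = (\<Sum>i\<in>A. 2 * rip (w i v) (w i u))"
    by (simp add: sum_distrib_left)
  also have "\<dots> \<le> (\<Sum>i\<in>A. rip (w i v) (w i v) + rip (w i u) (w i u))"
    by (intro sum_mono two_rip_le)
  also have "\<dots> \<le> rip v v + rip u u"
    using col [of v] col [of u] by (simp add: sum.distrib)
  finally show "norm (\<Sum>i\<in>A. adj (w i) (w i v)) \<le> 1 * norm v"
    by (simp add: norm_le_iff_rip flip: u_def)
qed simp

section \<open>Commutants and square roots\<close>

lemma commutant_bop: "T \<in> commutant N \<Longrightarrow> bop T"
  by (simp add: commutant_def)

lemma commutant_commute: "T \<in> commutant N \<Longrightarrow> A \<in> N \<Longrightarrow> T (A x) = A (T x)"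
  unfolding commutant_def by (metis (mono_tags, lifting) comp_apply mem_Collect_eq)

lemma commutantI: "bop T \<Longrightarrow> (\<And>A x. A \<in> N \<Longrightarrow> T (A x) = A (T x)) \<Longrightarrow> T \<in> commutant N"
  by (auto simp: commutant_def fun_eq_iff)

lemma commutant_comp:
  assumes S: "S \<in> commutant N" and T: "T \<in> commutant N"
  shows "S \<circ> T \<in> commutant N"
proof (rule commutantI)
  show "bop (S \<circ> T)" by (intro bop_comp commutant_bop [OF S] commutant_bop [OF T])
  show "(S \<circ> T) (A x) = A ((S \<circ> T) x)" if "A \<in> N" for A x
    using commutant_commute [OF T that] commutant_commute [OF S that] by simp
qed

lemma commutant_plus:
  assumes N: "N \<subseteq> Collect bop" and S: "S \<in> commutant N" and T: "T \<in> commutant N"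
  shows "S + T \<in> commutant N"
proof (rule commutantI)
  show "bop (S + T)" by (intro bop_plus commutant_bop [OF S] commutant_bop [OF T])
  fix A x assume A: "A \<in> N"
  then have "bop A" using N by blast
  then show "(S + T) (A x) = A ((S + T) x)"
    using commutant_commute [OF T A] commutant_commute [OF S A] by (simp add: bop_add)
qed

lemma commutant_scaleR:
  assumes N: "N \<subseteq> Collect bop" and T: "T \<in> commutant N"
  shows "r *\<^sub>R T \<in> commutant N"
proof (rule commutantI)
  show "bop (r *\<^sub>R T)" by (intro bop_scaleR_fun commutant_bop [OF T])
  fix A x assume A: "A \<in> N"
  then have "bop A" using N by blast
  then show "(r *\<^sub>R T) (A x) = A ((r *\<^sub>R T) x)"
    using commutant_commute [OF T A] by (simp add: bop_scaleR)
qed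

lemma commutant_id: "id \<in> commutant N"
  by (intro commutantI bop_id) auto

lemma commutant_zero: "N \<subseteq> Collect bop \<Longrightarrow> 0 \<in> commutant N"
  using commutant_scaleR [OF _ commutant_id, of N 0] by simp

lemma subspace_commutant: "N \<subseteq> Collect bop \<Longrightarrow> subspace (commutant N)"
  by (simp add: subspace_def commutant_zero commutant_plus commutant_scaleR)

lemma commutant_sum:
  assumes N: "N \<subseteq> Collect bop" and f: "\<And>i. i \<in> A \<Longrightarrow> f i \<in> commutant N"
  shows "(\<lambda>v. \<Sum>i\<in>A. f i v) \<in> commutant N"
proof -
  have "(\<Sum>i\<in>A. f i) \<in> commutant N"
    using subspace_sum [OF subspace_commutant [OF N], of A f] f by blast
  moreover have "(\<Sum>i\<in>A. f i) v = (\<Sum>i\<in>A. f i v)" for v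
    by (induction A rule: infinite_finite_induct) auto
  then have "(\<Sum>i\<in>A. f i) = (\<lambda>v. \<Sum>i\<in>A. f i v)" by (intro ext)
  ultimately show ?thesis by simp
qed

lemma bop_scaleC_fun: "bop (scaleC c :: 'a::complex_hilbert \<Rightarrow> 'a)"
proof -
  have "bounded_linear (scaleC c :: 'a \<Rightarrow> 'a)"
  proof (rule bounded_linear_intro)
    show "scaleC c (x + y) = scaleC c x + scaleC c y" for x y :: 'a
      by (rule scaleC_add_right)
    show "scaleC c (r *\<^sub>R x) = r *\<^sub>R scaleC c x" for r and x :: 'a
      by (simp add: scaleR_scaleC scaleC_scaleC mult.commute)
    show "norm (scaleC c x) \<le> norm x * cmod c" for x :: 'a
    proof -
      have "(norm (scaleC c x))\<^sup>2 = rip x (scaleC (cnj c * c) x)"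
        by (simp add: power2_norm_eq_rip rip_scaleC scaleC_scaleC)
      also have "cnj c * c = complex_of_real ((cmod c)\<^sup>2)"
        using complex_norm_square [of c] by (simp add: mult.commute)
      also have "rip x (scaleC \<dots> x) = (norm x * cmod c)\<^sup>2"
        by (simp add: rip.scaleR_right power_mult_distrib power2_norm_eq_rip flip: scaleR_scaleC)
      finally show ?thesis by (simp add: power2_eq_iff_nonneg)
    qed
  qed
  then show ?thesis by (simp add: bop_def scaleC_scaleC mult.commute)
qed

definition comm_blin :: "('a::complex_hilbert \<Rightarrow> 'a) set \<Rightarrow> ('a \<Rightarrow>\<^sub>L 'a) set"
  where "comm_blin N = {T. blinfun_apply T \<in> commutant N}"

lemma closed_comm_blin:
  assumes N: "N \<subseteq> Collect bop"
  shows "closed (comm_blin N)"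
proof -
  have "comm_blin N = {T. \<forall>c x. blinfun_apply T (scaleC c x) = scaleC c (blinfun_apply T x)}
      \<inter> (\<Inter>A\<in>N. {T. \<forall>x. blinfun_apply T (A x) = A (blinfun_apply T x)})"
    by (auto simp: comm_blin_def commutant_def bop_def fun_eq_iff blinfun.bounded_linear_right)
  also have "closed \<dots>"
  proof (intro closed_Int closed_INT ballI closed_Collect_all closed_Collect_eq
      bounded_linear.continuous_on [OF bop_bounded_linear [OF bop_scaleC_fun]] continuous_intros)
    fix A x assume "A \<in> N"
    then have "bounded_linear A" using N bop_bounded_linear by blast
    then show "continuous_on UNIV (\<lambda>T. A (blinfun_apply T x))"
      by (rule bounded_linear.continuous_on) (intro continuous_intros)
  qed
  finally show ?thesis .
qed

lemma blinfun_fixpoint: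
  fixes \<Phi> :: "('a::banach \<Rightarrow>\<^sub>L 'a) \<Rightarrow> 'a \<Rightarrow>\<^sub>L 'a"
  assumes "closed X" "X \<noteq> {}" "0 \<le> c" "c < 1" "\<And>S. S \<in> X \<Longrightarrow> \<Phi> S \<in> X"
    and "\<And>S S'. S \<in> X \<Longrightarrow> S' \<in> X \<Longrightarrow> norm (\<Phi> S - \<Phi> S') \<le> c * norm (S - S')"
  obtains S where "S \<in> X" "\<Phi> S = S"
proof -
  have "\<exists>!x\<in>X. \<Phi> x = x"
    using assms by (intro Banach_fix [where c = c]) (auto simp: complete_eq_closed dist_norm)
  then show ?thesis using that by blast
qed

lemma comm_blin_ops:
  assumes N: "N \<subseteq> Collect bop"
  shows "S \<in> comm_blin N \<Longrightarrow> T \<in> comm_blin N \<Longrightarrow> S o\<^sub>L T \<in> comm_blin N"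
    and "S \<in> comm_blin N \<Longrightarrow> T \<in> comm_blin N \<Longrightarrow> S + T \<in> comm_blin N"
    and "S \<in> comm_blin N \<Longrightarrow> r *\<^sub>R S \<in> comm_blin N"
    and "0 \<in> comm_blin N" and "id_blinfun \<in> comm_blin N"
proof -
  have comp: "blinfun_apply (S o\<^sub>L T) = blinfun_apply S \<circ> blinfun_apply T"
    and plus: "blinfun_apply (S + T) = blinfun_apply S + blinfun_apply T"
    and scale: "blinfun_apply (r *\<^sub>R S) = r *\<^sub>R blinfun_apply S"
    and zero: "blinfun_apply (0 :: 'a \<Rightarrow>\<^sub>L 'a) = 0"
    and one: "blinfun_apply (id_blinfun :: 'a \<Rightarrow>\<^sub>L 'a) = id" for S T :: "'a \<Rightarrow>\<^sub>L 'a" and r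
    by (auto simp: fun_eq_iff blinfun.add_left blinfun.scaleR_left)
  show "S \<in> comm_blin N \<Longrightarrow> T \<in> comm_blin N \<Longrightarrow> S o\<^sub>L T \<in> comm_blin N"
    and "S \<in> comm_blin N \<Longrightarrow> T \<in> comm_blin N \<Longrightarrow> S + T \<in> comm_blin N"
    and "S \<in> comm_blin N \<Longrightarrow> r *\<^sub>R S \<in> comm_blin N"
    and "0 \<in> comm_blin N" and "id_blinfun \<in> comm_blin N"
    unfolding comm_blin_def mem_Collect_eq comp plus scale zero one
    by (blast intro: commutant_comp commutant_plus [OF N] commutant_scaleR [OF N] commutant_zero [OF N] commutant_id)+
qed

text \<open>The square root of \<open>c (1 - T)\<close> is \<open>sqrt c (1 - S)\<close> where \<open>S\<close> solves \<open>S = (T + S^2) / 2\<close>,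
  and \<open>1 - S\<close> is inverted by solving \<open>X = 1 + S X\<close>; both maps are contractions.\<close>

lemma sqrt_contraction_fixpoint:
  fixes T :: "'a::complex_hilbert \<Rightarrow>\<^sub>L 'a"
  assumes N: "N \<subseteq> Collect bop" and T: "T \<in> comm_blin N"
    and sa: "\<And>x y. rip (T x) y = rip x (T y)" and q: "norm T \<le> q" "0 \<le> q" "q < 1"
  obtains S where "S \<in> comm_blin N" "\<And>x y. rip (S x) y = rip x (S y)" "norm S < 1"
    "2 *\<^sub>R S = T + (S o\<^sub>L S)"
proof -
  define r where "r = 1 - sqrt (1 - q)"
  have sq: "0 < sqrt (1 - q)" "sqrt (1 - q) \<le> 1" "(sqrt (1 - q))\<^sup>2 = 1 - q" using q by auto
  then have r: "0 \<le> r" "r < 1" by (auto simp: r_def)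
  have rr: "q + r * r = 2 * r" using sq(3) by (simp add: r_def power2_eq_square algebra_simps)
  define X where "X = comm_blin N \<inter> {S. \<forall>x y. rip (blinfun_apply S x) y = rip x (blinfun_apply S y)} \<inter> cball 0 r"
  define \<Phi> where "\<Phi> S = (1/2) *\<^sub>R (T + (S o\<^sub>L S))" for S
  obtain S where S: "S \<in> X" "\<Phi> S = S"
  proof (rule blinfun_fixpoint [of X r \<Phi>])
    have "closed {S::'a \<Rightarrow>\<^sub>L 'a. \<forall>x y. rip (blinfun_apply S x) y = rip x (blinfun_apply S y)}"
      by (intro closed_Collect_all closed_Collect_eq rip.continuous_on continuous_intros)
    then show "closed X" unfolding X_def
      by (intro closed_Int closed_comm_blin closed_cball N)
    have "0 \<in> X" using comm_blin_ops(4) [OF N] r by (simp add: X_def rip.zero_left rip.zero_right)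
    then show "X \<noteq> {}" by blast
    show "0 \<le> r" "r < 1" by fact+
    show "\<Phi> S \<in> X" if "S \<in> X" for S
    proof -
      have S: "S \<in> comm_blin N" "\<And>x y. rip (S x) y = rip x (S y)" "norm S \<le> r"
        using that by (auto simp: X_def)
      have "norm (S o\<^sub>L S) \<le> r * r"
        using norm_blinfun_compose [of S S] mult_mono [OF S(3) S(3)] r by simp
      then have "norm (\<Phi> S) \<le> r"
        using norm_triangle_ineq [of T "S o\<^sub>L S"] q(1) rr by (simp add: \<Phi>_def)
      moreover have "\<Phi> S \<in> comm_blin N"
        unfolding \<Phi>_def by (intro comm_blin_ops N T S)
      moreover have "rip (\<Phi> S x) y = rip x (\<Phi> S y)" for x y
        by (simp add: \<Phi>_def blinfun.add_left blinfun.scaleR_left rip.add_left rip.add_right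
            rip.scaleR_left rip.scaleR_right sa S)
      ultimately show ?thesis by (simp add: X_def)
    qed
    show "norm (\<Phi> S - \<Phi> S') \<le> r * norm (S - S')" if "S \<in> X" "S' \<in> X" for S S'
    proof -
      have n: "norm S \<le> r" "norm S' \<le> r" using that by (auto simp: X_def)
      have "\<Phi> S - \<Phi> S' = (1/2) *\<^sub>R ((S o\<^sub>L (S - S')) + ((S - S') o\<^sub>L S'))"
        by (rule blinfun_eqI)
          (simp add: \<Phi>_def blinfun.add_left blinfun.diff_left blinfun.scaleR_left
            blinfun.diff_right algebra_simps)
      also have "norm \<dots> \<le> (1/2) * (norm S * norm (S - S') + norm (S - S') * norm S')"
        using norm_triangle_ineq [of "S o\<^sub>L (S - S')" "(S - S') o\<^sub>L S'"]
          norm_blinfun_compose [of S "S - S'"] norm_blinfun_compose [of "S - S'" S'] by simp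
      also have "\<dots> \<le> (1/2) * (r * norm (S - S') + norm (S - S') * r)"
        using n by (intro mult_left_mono add_mono mult_right_mono mult_left_mono) auto
      finally show ?thesis by (simp add: mult.commute)
    qed
  qed
  have "2 *\<^sub>R \<Phi> S = T + (S o\<^sub>L S)" unfolding \<Phi>_def by simp
  then show ?thesis using S r by (intro that [of S]) (auto simp: X_def)
qed

lemma inverse_one_minus:
  fixes S :: "'a::complex_hilbert \<Rightarrow>\<^sub>L 'a"
  assumes N: "N \<subseteq> Collect bop" and S: "S \<in> comm_blin N" "norm S < 1"
  obtains X where "X \<in> comm_blin N" "\<And>x. X x - S (X x) = x" "\<And>x. X (x - S x) = x"
proof -
  obtain X where X: "X \<in> comm_blin N" "id_blinfun + (S o\<^sub>L X) = X"
  proof (rule blinfun_fixpoint [of "comm_blin N" "norm S" "\<lambda>X. id_blinfun + (S o\<^sub>L X)"])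
    show "norm (id_blinfun + (S o\<^sub>L X) - (id_blinfun + (S o\<^sub>L Y))) \<le> norm S * norm (X - Y)" for X Y
    proof -
      have "id_blinfun + (S o\<^sub>L X) - (id_blinfun + (S o\<^sub>L Y)) = S o\<^sub>L (X - Y)"
        by (rule blinfun_eqI) (simp add: blinfun.add_left blinfun.diff_left blinfun.diff_right)
      then show ?thesis by (simp add: norm_blinfun_compose)
    qed
    show "comm_blin N \<noteq> {}" using comm_blin_ops [OF N] by blast
    show "id_blinfun + (S o\<^sub>L X) \<in> comm_blin N" if "X \<in> comm_blin N" for X
      by (intro comm_blin_ops N S that)
  qed (use S closed_comm_blin [OF N] in auto)
  have right: "X x - S (X x) = x" for x
    using arg_cong [OF X(2), of "\<lambda>Y. blinfun_apply Y x"] by (simp add: blinfun.add_left algebra_simps)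
  have inj: "x = 0" if "x = S x" for x
  proof (rule ccontr)
    assume "x \<noteq> 0"
    then have "norm S * norm x < norm x" using S(2) by simp
    then show False using norm_blinfun [of S x] that by simp
  qed
  have "X (x - S x) - x = S (X (x - S x) - x)" for x
    using right [of "x - S x"] by (simp add: blinfun.diff_right blinfun.add_right algebra_simps)
  then have "X (x - S x) = x" for x using inj [of "X (x - S x) - x"] by simp
  with X right that show ?thesis by blast
qed

lemma commutant_sqrt:
  fixes K :: "'a::complex_hilbert \<Rightarrow> 'a"
  assumes N: "N \<subseteq> Collect bop" and K: "K \<in> commutant N"
    and sa: "\<And>x y. rip (K x) y = rip x (K y)"
    and eps: "\<epsilon> > 0" "\<And>x. \<epsilon> * rip x x \<le> rip x (K x)"
  obtains k l where "k \<in> commutant N" "l \<in> commutant N"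
    "\<And>x y. rip (k x) y = rip x (k y)" "\<And>x y. rip (l x) y = rip x (l y)"
    "\<And>x. k (k x) = K x" "\<And>x. k (l x) = x" "\<And>x. l (k x) = x"
proof -
  define KB where "KB = Blinfun K"
  have KB: "blinfun_apply KB = K"
    unfolding KB_def using bounded_linear_Blinfun_apply K commutant_bop bop_bounded_linear by blast
  define L where "L = norm KB + \<epsilon>"
  have L: "L > 0" "\<epsilon> \<le> L" using eps by (auto simp: L_def intro: add_nonneg_pos)
  have KL: "rip (K x) (K x) \<le> L\<^sup>2 * rip x x" for x
  proof -
    have "norm (K x) \<le> L * norm x"
      using norm_blinfun [of KB x] KB eps by (simp add: L_def algebra_simps order_trans)
    then have "(norm (K x))\<^sup>2 \<le> (L * norm x)\<^sup>2" by (intro power_mono) auto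
    then show ?thesis by (simp add: power_mult_distrib power2_norm_eq_rip)
  qed
  define c where "c = L\<^sup>2 / \<epsilon>"
  have c: "c > 0" using L eps by (simp add: c_def)
  define T where "T = id_blinfun + (- 1 / c) *\<^sub>R KB"
  have Tx: "blinfun_apply T x = x - (1 / c) *\<^sub>R K x" for x
    by (simp add: T_def blinfun.diff_left blinfun.scaleR_left KB)
  define q where "q = sqrt (1 - (\<epsilon> / L)\<^sup>2)"
  have eL: "0 < (\<epsilon> / L)\<^sup>2" "(\<epsilon> / L)\<^sup>2 \<le> 1" using eps L by (auto simp: power_le_one)
  have q: "0 \<le> q" "q < 1" "q\<^sup>2 = 1 - (\<epsilon> / L)\<^sup>2" using eL by (auto simp: q_def)
  have "norm (T x) \<le> q * norm x" for x
  proof (rule power2_le_imp_le)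
    have "(norm (T x))\<^sup>2 = rip x x - 2 / c * rip x (K x) + 1 / c\<^sup>2 * rip (K x) (K x)"
      unfolding power2_norm_eq_rip Tx rip_diff_self
      by (simp add: rip.scaleR_left rip.scaleR_right power2_eq_square)
    also have "\<dots> \<le> rip x x - 2 / c * (\<epsilon> * rip x x) + 1 / c\<^sup>2 * (L\<^sup>2 * rip x x)"
      using c eps KL by (intro add_mono diff_mono mult_left_mono) auto
    also have "\<dots> = (1 - (\<epsilon> / L)\<^sup>2) * rip x x"
      using L eps by (simp add: c_def field_simps power2_eq_square)
    also have "\<dots> = (q * norm x)\<^sup>2"
      by (simp only: q(3) power_mult_distrib power2_norm_eq_rip)
    finally show "(norm (T x))\<^sup>2 \<le> (q * norm x)\<^sup>2" .
  qed (use q in auto)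
  then have nT: "norm T \<le> q" using q by (intro norm_blinfun_bound) auto
  have "KB \<in> comm_blin N" using K KB by (simp add: comm_blin_def)
  then have TN: "T \<in> comm_blin N" unfolding T_def by (intro comm_blin_ops N)
  obtain S where S: "S \<in> comm_blin N" "\<And>x y. rip (S x) y = rip x (S y)" "norm S < 1"
    "2 *\<^sub>R S = T + (S o\<^sub>L S)"
    by (rule sqrt_contraction_fixpoint [OF N TN _ nT q(1,2)])
      (auto simp: Tx rip.diff_left rip.diff_right rip.scaleR_left rip.scaleR_right sa)
  obtain X where X: "X \<in> comm_blin N" "\<And>x. X x - S (X x) = x" "\<And>x. X (x - S x) = x"
    using inverse_one_minus [OF N S(1,3)] by blast
  define s where "s = sqrt c"
  have s: "s > 0" "s * s = c" using c by (auto simp: s_def)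
  define k where "k x = s *\<^sub>R (x - S x)" for x
  define l where "l x = (1 / s) *\<^sub>R X x" for x
  have kl: "k (l x) = x" "l (k x) = x" for x
    using s X(2,3) [of x] by (simp_all add: k_def l_def blinfun.scaleR_right flip: scaleR_diff_right)
  have ksa: "rip (k x) y = rip x (k y)" for x y
    by (simp add: k_def rip.scaleR_left rip.scaleR_right rip.diff_left rip.diff_right S)
  show ?thesis
  proof (rule that [of k l])
    have "blinfun_apply (s *\<^sub>R (id_blinfun + (-1) *\<^sub>R S)) = k"
      by (auto simp: k_def blinfun.scaleR_left blinfun.diff_left)
    moreover have "s *\<^sub>R (id_blinfun + (-1) *\<^sub>R S) \<in> comm_blin N"
      by (intro comm_blin_ops N S)
    ultimately show "k \<in> commutant N" by (simp add: comm_blin_def)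
    have "blinfun_apply ((1/s) *\<^sub>R X) = l"
      by (auto simp: l_def blinfun.scaleR_left)
    moreover have "(1/s) *\<^sub>R X \<in> comm_blin N"
      by (intro comm_blin_ops N X)
    ultimately show "l \<in> commutant N" by (simp add: comm_blin_def)
    show "k (k x) = K x" for x
    proof -
      have "2 *\<^sub>R S x = T x + S (S x)"
        using arg_cong [OF S(4), of "\<lambda>Y. blinfun_apply Y x"] by (simp add: blinfun.add_left blinfun.scaleR_left)
      then have "x - S x - S (x - S x) = (1 / c) *\<^sub>R K x"
        by (simp add: Tx blinfun.diff_right algebra_simps scaleR_2)
      then have "c *\<^sub>R (x - S x - S (x - S x)) = K x" using c by simp
      then show ?thesis
        by (simp add: k_def blinfun.scaleR_right s flip: scaleR_diff_right)
    qed
    show "rip (k x) y = rip x (k y)" for x y by (rule ksa)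
    show "rip (l x) y = rip x (l y)" for x y
      using ksa [of "l x" "l y"] by (simp add: kl)
  qed (rule kl)+
qed

section \<open>Algebras with a cyclic vector\<close>

lemma abs_le_mult_of_quadratic:
  fixes B p q :: real
  assumes "\<And>s. 2 * (s * B) \<le> p\<^sup>2 + s\<^sup>2 * q\<^sup>2" and "0 \<le> p" "0 \<le> q"
  shows "\<bar>B\<bar> \<le> p * q"
proof (cases "q = 0")
  case True
  have "B = 0"
  proof (rule ccontr)
    assume "B \<noteq> 0"
    then show False using assms(1) [of "(p\<^sup>2 + 1) / B"] True zero_le_power2 [of p] by (auto simp del: zero_le_power2)
  qed
  then show ?thesis using True by simp
next
  case False
  have "2 * (B\<^sup>2 / q\<^sup>2) \<le> p\<^sup>2 + B\<^sup>2 / q\<^sup>2"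
    using assms(1) [of "B / q\<^sup>2"] False by (simp add: power2_eq_square)
  then have "B\<^sup>2 / q\<^sup>2 \<le> p\<^sup>2" by simp
  then have "B\<^sup>2 \<le> (p * q)\<^sup>2"
    using False by (simp add: divide_le_eq power_mult_distrib)
  then show ?thesis using assms(2,3) by (simp add: abs_le_square_iff [symmetric])
qed

locale cyclic_vN_algebra =
  fixes M :: "('a::complex_hilbert \<Rightarrow> 'a) set" and \<xi> :: 'a
  assumes vN: "von_neumann_algebra M" and cyc: "cyclic_vector M \<xi>"
begin

lemma M_bop: "A \<in> M \<Longrightarrow> bop A"
  and M_adj: "A \<in> M \<Longrightarrow> adj A \<in> M"
  and bicommutant: "commutant (commutant M) = M"
  using vN by (auto simp: von_neumann_algebra_def)

lemma M_subset_bop: "M \<subseteq> Collect bop"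
  using M_bop by blast

lemma commutant_subset_bop: "commutant M \<subseteq> Collect bop"
  using commutant_bop by blast

lemmas M_comp = commutant_comp [where N = "commutant M", unfolded bicommutant]
  and M_plus = commutant_plus [OF commutant_subset_bop, unfolded bicommutant]
  and M_scaleR = commutant_scaleR [OF commutant_subset_bop, unfolded bicommutant]
  and M_id = commutant_id [where N = "commutant M", unfolded bicommutant]
  and M_zero = commutant_zero [OF commutant_subset_bop, unfolded bicommutant]
  and M_sum = commutant_sum [OF commutant_subset_bop, unfolded bicommutant]
  and M_subspace = subspace_commutant [OF commutant_subset_bop, unfolded bicommutant]
  and M_sqrt = commutant_sqrt [OF commutant_subset_bop, unfolded bicommutant]

lemma M_scaleC: "scaleC c \<in> M"
proof -
  have "scaleC c \<in> commutant (commutant M)"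
    by (intro commutantI bop_scaleC_fun) (simp add: bop_scaleC commutant_bop)
  then show ?thesis by (simp add: bicommutant)
qed

lemma commutant_adj:
  assumes T: "T \<in> commutant M"
  shows "adj T \<in> commutant M"
proof (rule commutantI)
  have bT: "bop T" using T by (rule commutant_bop)
  then show "bop (adj T)" by (rule bop_adj)
  fix A x assume A: "A \<in> M"
  show "adj T (A x) = A (adj T x)"
  proof (rule rip_ext)
    fix z
    have "rip z (adj T (A x)) = rip (adj A (T z)) x"
      by (simp add: rip_adj_left M_bop A flip: rip_adj [OF bT])
    also have "adj A (T z) = T (adj A z)"
      using commutant_commute [OF T M_adj [OF A]] by simp
    also have "rip (T (adj A z)) x = rip z (A (adj T x))"
      by (simp add: rip_adj [OF bT] rip_adj_left M_bop A)
    finally show "rip z (adj T (A x)) = rip z (A (adj T x))" .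
  qed
qed

lemma dense: "closure ((\<lambda>A. A \<xi>) ` M) = UNIV"
  using cyc by (simp add: cyclic_vector_def setcompr_eq_image)

lemma dense_sequence: "\<exists>f. (\<forall>k::nat. f k \<in> M) \<and> (\<lambda>k. f k \<xi>) \<longlonglongrightarrow> h"
proof -
  have "h \<in> closure ((\<lambda>A. A \<xi>) ` M)" using dense by simp
  then obtain u where u: "\<forall>k. u k \<in> (\<lambda>A. A \<xi>) ` M" "u \<longlonglongrightarrow> h"
    unfolding closure_sequential by blast
  then have "\<forall>k. \<exists>x. x \<in> M \<and> u k = x \<xi>" by blast
  then obtain f where f: "\<forall>k. f k \<in> M \<and> u k = f k \<xi>" by metis
  then have "u = (\<lambda>k. f k \<xi>)" by auto
  with f u(2) show ?thesis by auto
qed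

lemma eq_on_cyclic_imp_eq:
  fixes f g :: "'a \<Rightarrow> 'b::t2_space"
  assumes "continuous_on UNIV f" "continuous_on UNIV g" "\<And>x. x \<in> M \<Longrightarrow> f (x \<xi>) = g (x \<xi>)"
  shows "f h = g h"
proof -
  have "closure ((\<lambda>A. A \<xi>) ` M) \<subseteq> {h. f h = g h}"
    using assms by (intro closure_minimal closed_Collect_eq) auto
  then show ?thesis using dense by auto
qed

lemma form_representation:
  assumes add_left: "\<And>m m' x. m \<in> M \<Longrightarrow> m' \<in> M \<Longrightarrow> x \<in> M \<Longrightarrow> B (m + m') x = B m x + B m' x"
    and scale_left: "\<And>r m x. m \<in> M \<Longrightarrow> x \<in> M \<Longrightarrow> B (r *\<^sub>R m) x = r * B m x"
    and add_right: "\<And>m x x'. m \<in> M \<Longrightarrow> x \<in> M \<Longrightarrow> x' \<in> M \<Longrightarrow> B m (x + x') = B m x + B m x'"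
    and scale_right: "\<And>r m x. m \<in> M \<Longrightarrow> x \<in> M \<Longrightarrow> B m (r *\<^sub>R x) = r * B m x"
    and bnd: "\<And>m x. m \<in> M \<Longrightarrow> x \<in> M \<Longrightarrow> \<bar>B m x\<bar> \<le> norm (m \<xi>) * norm (x \<xi>)"
    and bimod: "\<And>c m x. c \<in> M \<Longrightarrow> m \<in> M \<Longrightarrow> x \<in> M \<Longrightarrow> B m (c \<circ> x) = B (adj c \<circ> m) x"
  obtains T where "T \<in> commutant M" "\<And>m x. m \<in> M \<Longrightarrow> x \<in> M \<Longrightarrow> B m x = rip (m \<xi>) (T (x \<xi>))"
proof -
  have "\<exists>z. \<forall>m\<in>M. B m x = rip (m \<xi>) z" if x: "x \<in> M" for x
  proof -
    obtain L where L: "bounded_linear L" "\<And>m. m \<in> M \<Longrightarrow> L (m \<xi>) = B m x"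
    proof (rule bounded_linear_extension [where e = "\<lambda>A. A \<xi>" and \<phi> = "\<lambda>m. B m x" and M = M and C = "norm (x \<xi>)"])
      show "norm (B m x) \<le> norm (x \<xi>) * norm (m \<xi>)" if "m \<in> M" for m
        using bnd [OF that x] by (simp add: mult.commute)
    qed (use M_subspace dense add_left scale_left x in auto)
    obtain z where "\<And>h. L h = rip z h" using Riesz_rip [OF L(1)] by blast
    then have "\<forall>m\<in>M. B m x = rip (m \<xi>) z" using L(2) by (metis rip_commute)
    then show ?thesis by blast
  qed
  then obtain \<phi> where \<phi>: "\<And>x m. x \<in> M \<Longrightarrow> m \<in> M \<Longrightarrow> B m x = rip (m \<xi>) (\<phi> x)" by metis
  have ext: "u = v" if "\<And>m. m \<in> M \<Longrightarrow> rip (m \<xi>) u = rip (m \<xi>) v" for u v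
  proof (rule rip_ext)
    show "rip h u = rip h v" for h
      by (rule eq_on_cyclic_imp_eq [of "\<lambda>h. rip h u" "\<lambda>h. rip h v"])
        (use that in \<open>auto intro!: rip.continuous_on continuous_intros\<close>)
  qed
  obtain T where T: "bounded_linear T" "\<And>x. x \<in> M \<Longrightarrow> T (x \<xi>) = \<phi> x"
  proof (rule bounded_linear_extension [where e = "\<lambda>A. A \<xi>" and \<phi> = \<phi> and M = M and C = 1])
    show "\<phi> (x + y) = \<phi> x + \<phi> y" if "x \<in> M" "y \<in> M" for x y
      by (rule ext) (simp add: rip.add_right that M_plus add_right flip: \<phi>)
    show "\<phi> (r *\<^sub>R x) = r *\<^sub>R \<phi> x" if "x \<in> M" for r x
      by (rule ext) (simp add: rip.scaleR_right that M_scaleR scale_right flip: \<phi>)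
    show "norm (\<phi> x) \<le> 1 * norm (x \<xi>)" if x: "x \<in> M" for x
    proof -
      obtain f where f: "\<forall>k::nat. f k \<in> M" "(\<lambda>k. f k \<xi>) \<longlonglongrightarrow> \<phi> x"
        using dense_sequence by blast
      have "rip (\<phi> x) (\<phi> x) \<le> norm (\<phi> x) * norm (x \<xi>)"
      proof (rule LIMSEQ_le [OF rip.tendsto [OF f(2) tendsto_const]
            tendsto_mult [OF tendsto_norm [OF f(2)] tendsto_const]])
        show "\<exists>N. \<forall>k\<ge>N. rip (f k \<xi>) (\<phi> x) \<le> norm (f k \<xi>) * norm (x \<xi>)"
          using bnd [OF _ x] f(1) x \<phi> by (intro exI [of _ 0]) (metis abs_le_D1)
      qed
      then have "norm (\<phi> x) * norm (\<phi> x) \<le> norm (\<phi> x) * norm (x \<xi>)"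
        by (simp add: power2_eq_square flip: power2_norm_eq_rip)
      then show ?thesis by (cases "\<phi> x = 0") auto
    qed
  qed (use M_subspace dense in auto)
  have comm: "T (c h) = c (T h)" if c: "c \<in> M" for c h
  proof (rule eq_on_cyclic_imp_eq [of "\<lambda>h. T (c h)" "\<lambda>h. c (T h)"])
    have bc: "bounded_linear c" using c M_bop bop_bounded_linear by blast
    show "continuous_on UNIV (\<lambda>h. T (c h))" "continuous_on UNIV (\<lambda>h. c (T h))"
      using bounded_linear_compose T(1) bc by (blast intro: linear_continuous_on)+
    fix x assume x: "x \<in> M"
    have cx: "c \<circ> x \<in> M" using c x by (rule M_comp)
    have "T ((c \<circ> x) \<xi>) = c (T (x \<xi>))"
    proof (rule ext)
      fix m assume m: "m \<in> M"
      have cm: "adj c \<circ> m \<in> M" using M_adj [OF c] m by (rule M_comp)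
      have "rip (m \<xi>) (T ((c \<circ> x) \<xi>)) = B (adj c \<circ> m) x"
        using T(2) [OF cx] \<phi> [OF cx m] bimod [OF c m x] by simp
      also have "\<dots> = rip (m \<xi>) (c (T (x \<xi>)))"
        using \<phi> [OF x cm] T(2) [OF x] by (simp add: rip_adj_left M_bop c)
      finally show "rip (m \<xi>) (T ((c \<circ> x) \<xi>)) = rip (m \<xi>) (c (T (x \<xi>)))" .
    qed
    then show "T (c (x \<xi>)) = c (T (x \<xi>))" by simp
  qed
  have "T \<in> commutant M"
    using T(1) comm M_scaleC by (intro commutantI) (auto simp: bop_def)
  moreover have "B m x = rip (m \<xi>) (T (x \<xi>))" if "m \<in> M" "x \<in> M" for m x
    using \<phi> T(2) that by simp
  ultimately show ?thesis by (rule that)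
qed

lemma onorm_row_le_1:
  fixes c :: "'i \<Rightarrow> 'a \<Rightarrow> 'a"
  assumes c: "\<And>i. i \<in> I \<Longrightarrow> c i \<in> commutant M"
    and bnd: "\<And>x m. (\<And>i. x i \<in> M) \<Longrightarrow> m \<in> M \<Longrightarrow>
      2 * rip (m \<xi>) (\<Sum>i\<in>I. c i (x i \<xi>)) \<le> (\<Sum>i\<in>I. rip (x i \<xi>) (x i \<xi>)) + rip (m \<xi>) (m \<xi>)"
  shows "onorm (\<lambda>v. \<Sum>i\<in>I. c i (adj (c i) v)) \<le> 1"
proof -
  have bc: "bop (c i)" if "i \<in> I" for i using c [OF that] by (rule commutant_bop)
  then have bl: "bounded_linear (c i)" if "i \<in> I" for i using that by (simp add: bop_bounded_linear)
  have ext: "2 * rip u (\<Sum>i\<in>I. c i (h i)) \<le> (\<Sum>i\<in>I. rip (h i) (h i)) + rip u u" for u h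
  proof -
    have "\<exists>f. \<forall>i. (\<forall>k::nat. f i k \<in> M) \<and> (\<lambda>k. f i k \<xi>) \<longlonglongrightarrow> h i"
      using dense_sequence by (intro choice) blast
    then obtain f where f: "\<And>i k. f i k \<in> M" "\<And>i. (\<lambda>k::nat. f i k \<xi>) \<longlonglongrightarrow> h i" by blast
    obtain g where g: "\<And>k::nat. g k \<in> M" "(\<lambda>k. g k \<xi>) \<longlonglongrightarrow> u" using dense_sequence by blast
    show ?thesis
    proof (rule LIMSEQ_le)
      show "(\<lambda>k. 2 * rip (g k \<xi>) (\<Sum>i\<in>I. c i (f i k \<xi>))) \<longlonglongrightarrow> 2 * rip u (\<Sum>i\<in>I. c i (h i))"
        by (intro tendsto_mult_left rip.tendsto g tendsto_sum bounded_linear.tendsto [OF bl] f)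
      show "(\<lambda>k. (\<Sum>i\<in>I. rip (f i k \<xi>) (f i k \<xi>)) + rip (g k \<xi>) (g k \<xi>))
          \<longlonglongrightarrow> (\<Sum>i\<in>I. rip (h i) (h i)) + rip u u"
        by (intro tendsto_add tendsto_sum rip.tendsto f g)
      show "\<exists>N. \<forall>k\<ge>N. 2 * rip (g k \<xi>) (\<Sum>i\<in>I. c i (f i k \<xi>))
          \<le> (\<Sum>i\<in>I. rip (f i k \<xi>) (f i k \<xi>)) + rip (g k \<xi>) (g k \<xi>)"
        by (intro exI allI impI bnd f g)
    qed
  qed
  have "onorm (\<lambda>v. \<Sum>i\<in>I. adj (adj (c i)) (adj (c i) v)) \<le> 1"
  proof (rule onorm_sum_adj_le_1)
    show "bop (adj (c i))" if "i \<in> I" for i using bc [OF that] by (rule bop_adj)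
    show "(\<Sum>i\<in>I. rip (adj (c i) v) (adj (c i) v)) \<le> rip v v" for v
    proof -
      have "rip v (\<Sum>i\<in>I. c i (adj (c i) v)) = (\<Sum>i\<in>I. rip (adj (c i) v) (adj (c i) v))"
        by (simp add: rip.sum_right bc rip_adj_left)
      then show ?thesis using ext [of v "\<lambda>i. adj (c i) v"] by simp
    qed
  qed
  then show ?thesis by (simp add: bc adj_adj cong: sum.cong)
qed

end

definition psd :: "('a::complex_hilbert \<Rightarrow> 'a) \<Rightarrow> bool"
  where "psd K \<longleftrightarrow> (\<forall>x y. rip (K x) y = rip x (K y)) \<and> (\<forall>x. 0 \<le> rip x (K x))"

text \<open>For invertible \<open>K\<close> and \<open>K'\<close> these say that the column (resp. the row) with entries
  \<open>K'\<^sup>-\<^sup>1\<^sup>/\<^sup>2 X i K\<^sup>-\<^sup>1\<^sup>/\<^sup>2\<close> is a contraction, but they are linear in \<open>(X, K, K')\<close>.\<close>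

definition col_dom :: "'i set \<Rightarrow> ('a::complex_hilbert \<Rightarrow> 'a) \<Rightarrow> ('a \<Rightarrow> 'a) \<Rightarrow> ('i \<Rightarrow> 'a \<Rightarrow> 'a) \<Rightarrow> bool"
  where "col_dom I K K' X \<longleftrightarrow>
    (\<forall>h g. 2 * (\<Sum>i\<in>I. rip (g i) (X i h)) \<le> rip h (K h) + (\<Sum>i\<in>I. rip (g i) (K' (g i))))"

definition row_dom :: "'i set \<Rightarrow> ('a::complex_hilbert \<Rightarrow> 'a) \<Rightarrow> ('a \<Rightarrow> 'a) \<Rightarrow> ('i \<Rightarrow> 'a \<Rightarrow> 'a) \<Rightarrow> bool"
  where "row_dom I K K' X \<longleftrightarrow>
    (\<forall>h g. 2 * (\<Sum>i\<in>I. rip h (X i (g i))) \<le> rip h (K' h) + (\<Sum>i\<in>I. rip (g i) (K (g i))))"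

lemma psd_zero: "psd 0"
  by (simp add: psd_def rip.zero_left rip.zero_right)

lemma psd_plus: "psd K \<Longrightarrow> psd L \<Longrightarrow> psd (K + L)"
  by (simp add: psd_def rip.add_left rip.add_right)

lemma psd_scaleR: "0 \<le> c \<Longrightarrow> psd K \<Longrightarrow> psd (c *\<^sub>R K)"
  by (simp add: psd_def rip.scaleR_left rip.scaleR_right)

lemma psd_gram:
  assumes "\<And>i. i \<in> A \<Longrightarrow> bop (x i)"
  shows "psd (\<lambda>v. \<Sum>i\<in>A. adj (x i) (x i v))"
  using assms by (simp add: psd_def rip.sum_left rip.sum_right sum_nonneg rip_adj_left flip: rip_adj)

lemma rip_gram:
  assumes "\<And>i. i \<in> A \<Longrightarrow> bop (x i)"
  shows "rip v (\<Sum>i\<in>A. adj (x i) (x i v)) = (\<Sum>i\<in>A. rip (x i v) (x i v))"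
  using assms by (simp add: rip.sum_right flip: rip_adj)

lemma psd_adj_comp: "bop m \<Longrightarrow> psd (adj m \<circ> m)"
  by (simp add: psd_def flip: rip_adj) (simp add: rip_adj_left)

lemma col_dom_zero: "psd K \<Longrightarrow> psd K' \<Longrightarrow> col_dom I K K' 0"
  and row_dom_zero: "psd K \<Longrightarrow> psd K' \<Longrightarrow> row_dom I K K' 0"
  by (simp_all add: col_dom_def row_dom_def psd_def rip.zero_right sum_nonneg)

lemma col_dom_plus: "col_dom I K K' X \<Longrightarrow> col_dom I L L' Y \<Longrightarrow> col_dom I (K + L) (K' + L') (X + Y)"
  and row_dom_plus: "row_dom I K K' X \<Longrightarrow> row_dom I L L' Y \<Longrightarrow> row_dom I (K + L) (K' + L') (X + Y)"
  unfolding col_dom_def row_dom_def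
  by (simp_all add: rip.add_right sum.distrib distrib_left) (smt (verit, best))+

lemma col_dom_scaleR:
  assumes c: "0 < c" and d: "col_dom I K K' X"
  shows "col_dom I (c *\<^sub>R K) (c *\<^sub>R K') (c *\<^sub>R X)"
  unfolding col_dom_def
proof (intro allI)
  fix h g
  have "2 * (\<Sum>i\<in>I. rip (g i) (X i h)) \<le> rip h (K h) + (\<Sum>i\<in>I. rip (g i) (K' (g i)))"
    using d unfolding col_dom_def by blast
  from mult_left_mono [OF this, of c] c
  show "2 * (\<Sum>i\<in>I. rip (g i) ((c *\<^sub>R X) i h))
      \<le> rip h ((c *\<^sub>R K) h) + (\<Sum>i\<in>I. rip (g i) ((c *\<^sub>R K') (g i)))"
    by (simp add: rip.scaleR_right sum_distrib_left distrib_left mult_ac)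
qed

lemma row_dom_scaleR:
  assumes c: "0 < c" and d: "row_dom I K K' X"
  shows "row_dom I (c *\<^sub>R K) (c *\<^sub>R K') (c *\<^sub>R X)"
  unfolding row_dom_def
proof (intro allI)
  fix h g
  have "2 * (\<Sum>i\<in>I. rip h (X i (g i))) \<le> rip h (K' h) + (\<Sum>i\<in>I. rip (g i) (K (g i)))"
    using d unfolding row_dom_def by blast
  from mult_left_mono [OF this, of c] c
  show "2 * (\<Sum>i\<in>I. rip h ((c *\<^sub>R X) i (g i)))
      \<le> rip h ((c *\<^sub>R K') h) + (\<Sum>i\<in>I. rip (g i) ((c *\<^sub>R K) (g i)))"
    by (simp add: rip.scaleR_right sum_distrib_left distrib_left mult_ac)
qed

lemma sum_two_rip_le: "2 * (\<Sum>i\<in>I. rip (u i) (v i)) \<le> (\<Sum>i\<in>I. rip (u i) (u i)) + (\<Sum>i\<in>I. rip (v i) (v i))"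
  unfolding sum_distrib_left sum.distrib [symmetric] by (intro sum_mono two_rip_le)

lemma col_dom_gram:
  assumes "\<And>i. bop (x i)" "bop m"
  shows "col_dom I (\<lambda>v. \<Sum>i\<in>I. adj (x i) (x i v)) (adj m \<circ> m) (\<lambda>i. adj m \<circ> x i)"
  unfolding col_dom_def
proof (intro allI)
  fix h g
  show "2 * (\<Sum>i\<in>I. rip (g i) ((adj m \<circ> x i) h))
      \<le> rip h (\<Sum>i\<in>I. adj (x i) (x i h)) + (\<Sum>i\<in>I. rip (g i) ((adj m \<circ> m) (g i)))"
    using sum_two_rip_le [of "\<lambda>i. m (g i)" "\<lambda>i. x i h" I] assms
    by (simp add: rip_gram flip: rip_adj)
qed

lemma row_dom_gram:
  assumes "\<And>i. bop (x i)" "bop m"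
  shows "row_dom I (adj m \<circ> m) (\<lambda>v. \<Sum>i\<in>I. adj (x i) (x i v)) (\<lambda>i. adj (x i) \<circ> m)"
  unfolding row_dom_def
proof (intro allI)
  fix h g
  show "2 * (\<Sum>i\<in>I. rip h ((adj (x i) \<circ> m) (g i)))
      \<le> rip h (\<Sum>i\<in>I. adj (x i) (x i h)) + (\<Sum>i\<in>I. rip (g i) ((adj m \<circ> m) (g i)))"
    using sum_two_rip_le [of "\<lambda>i. x i h" "\<lambda>i. m (g i)" I] assms
    by (simp add: rip_gram flip: rip_adj)
qed

section \<open>The decomposition\<close>

context cyclic_vN_algebra
begin

lemma dominated_row_column_bound:
  fixes y :: "nat \<Rightarrow> 'a \<Rightarrow> 'a"
  assumes y: "\<forall>i\<in>{1..n}. y i \<in> commutant M"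
    and bound: "\<forall>x :: nat \<Rightarrow> 'a \<Rightarrow> 'a. (\<forall>i\<in>{1..n}. x i \<in> M) \<longrightarrow>
        onorm (\<lambda>v. \<Sum>i=1..n. x i (y i v))
          \<le> max (sqrt (onorm (\<lambda>v. \<Sum>i=1..n. adj (x i) (x i v))))
                 (sqrt (onorm (\<lambda>v. \<Sum>i=1..n. x i (adj (x i) v))))"
    and X: "\<And>i. X i \<in> M" and K: "K \<in> M" "psd K" "K' \<in> M" "psd K'"
    and col: "col_dom {1..n} K K' X" and row: "row_dom {1..n} K K' X"
  shows "2 * rip \<xi> (\<Sum>i=1..n. X i (y i \<xi>)) \<le> rip \<xi> (K \<xi>) + rip \<xi> (K' \<xi>)"
proof (rule field_le_epsilon)
  fix e :: real assume e: "e > 0"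
  define \<epsilon> where "\<epsilon> = e / (2 * rip \<xi> \<xi> + 1)"
  have eps: "\<epsilon> > 0" "2 * \<epsilon> * rip \<xi> \<xi> \<le> e"
    using e rip_self_ge_0 [of \<xi>] by (auto simp: \<epsilon>_def field_simps add_pos_nonneg)
  define I where "I = {1..n}"
  define L where "L = K + \<epsilon> *\<^sub>R id"
  define L' where "L' = K' + \<epsilon> *\<^sub>R id"
  have LM: "L \<in> M" "L' \<in> M" unfolding L_def L'_def by (intro M_plus M_scaleR M_id K)+
  have Lx: "rip x (L x) = rip x (K x) + \<epsilon> * rip x x" "rip x (L' x) = rip x (K' x) + \<epsilon> * rip x x" for x
    by (simp_all add: L_def L'_def rip.add_right rip.scaleR_right)
  have Lsa: "rip (L x) z = rip x (L z)" "rip (L' x) z = rip x (L' z)" for x z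
    using K by (simp_all add: psd_def L_def L'_def rip.add_right rip.scaleR_right rip.add_left rip.scaleR_left)
  have Lpos: "\<epsilon> * rip x x \<le> rip x (L x)" "\<epsilon> * rip x x \<le> rip x (L' x)" for x
    using K by (simp_all add: Lx psd_def)
  have le: "rip x (K x) \<le> rip x (L x)" "rip x (K' x) \<le> rip x (L' x)" for x
    using eps by (simp_all add: Lx)
  have colL: "2 * (\<Sum>i\<in>I. rip (g i) (X i h)) \<le> rip h (L h) + (\<Sum>i\<in>I. rip (g i) (L' (g i)))" for h g
  proof -
    have "2 * (\<Sum>i\<in>I. rip (g i) (X i h)) \<le> rip h (K h) + (\<Sum>i\<in>I. rip (g i) (K' (g i)))"
      using col unfolding col_dom_def I_def by blast
    also have "\<dots> \<le> rip h (L h) + (\<Sum>i\<in>I. rip (g i) (L' (g i)))"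
      by (intro add_mono sum_mono le)
    finally show ?thesis .
  qed
  have rowL: "2 * (\<Sum>i\<in>I. rip h (X i (g i))) \<le> rip h (L' h) + (\<Sum>i\<in>I. rip (g i) (L (g i)))" for h g
  proof -
    have "2 * (\<Sum>i\<in>I. rip h (X i (g i))) \<le> rip h (K' h) + (\<Sum>i\<in>I. rip (g i) (K (g i)))"
      using row unfolding row_dom_def I_def by blast
    also have "\<dots> \<le> rip h (L' h) + (\<Sum>i\<in>I. rip (g i) (L (g i)))"
      by (intro add_mono sum_mono le)
    finally show ?thesis .
  qed
  obtain k l where k: "k \<in> M" "l \<in> M" "\<And>x y. rip (k x) y = rip x (k y)"
    "\<And>x y. rip (l x) y = rip x (l y)" "\<And>x. k (k x) = L x" "\<And>x. k (l x) = x" "\<And>x. l (k x) = x"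
    using M_sqrt [OF LM(1) Lsa(1) eps(1) Lpos(1)] by blast
  obtain k' l' where k': "k' \<in> M" "l' \<in> M" "\<And>x y. rip (k' x) y = rip x (k' y)"
    "\<And>x y. rip (l' x) y = rip x (l' y)" "\<And>x. k' (k' x) = L' x" "\<And>x. k' (l' x) = x" "\<And>x. l' (k' x) = x"
    using M_sqrt [OF LM(2) Lsa(2) eps(1) Lpos(2)] by blast
  have lL: "rip (l x) (L (l x)) = rip x x" for x
    by (simp add: k(4,6) flip: k(5)) (simp add: k(7))
  have lL': "rip (l' x) (L' (l' x)) = rip x x" for x
    by (simp add: k'(4,6) flip: k'(5)) (simp add: k'(7))
  define z where "z i = l' \<circ> (X i \<circ> l)" for i
  have zM: "z i \<in> M" for i unfolding z_def by (intro M_comp k' k X)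
  have zb: "bop (z i)" for i using zM by (rule M_bop)
  have colz: "(\<Sum>i\<in>I. rip (z i h) (z i h)) \<le> rip h h" for h
  proof -
    have "rip (l' (z i h)) (X i (l h)) = rip (z i h) (z i h)" for i
      by (simp add: k'(4)) (simp add: z_def)
    then show ?thesis using colL [of "\<lambda>i. l' (z i h)" "l h"] by (simp add: lL lL')
  qed
  have rowz: "(\<Sum>i\<in>I. rip (adj (z i) h) (adj (z i) h)) \<le> rip h h" for h
  proof -
    have "rip (l' h) (X i (l (adj (z i) h))) = rip (adj (z i) h) (adj (z i) h)" for i
      by (simp add: k'(4) rip_adj_left [OF zb]) (simp add: z_def)
    then show ?thesis using rowL [of "l' h" "\<lambda>i. l (adj (z i) h)"] by (simp add: lL lL')
  qed
  have "onorm (\<lambda>v. \<Sum>i\<in>I. adj (z i) (z i v)) \<le> 1"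
    by (rule onorm_sum_adj_le_1) (rule zb colz)+
  moreover have "onorm (\<lambda>v. \<Sum>i\<in>I. adj (adj (z i)) (adj (z i) v)) \<le> 1"
    by (rule onorm_sum_adj_le_1) (rule bop_adj zb rowz)+
  then have "onorm (\<lambda>v. \<Sum>i\<in>I. z i (adj (z i) v)) \<le> 1"
    by (simp add: adj_adj [OF zb])
  ultimately have "max (sqrt (onorm (\<lambda>v. \<Sum>i\<in>I. adj (z i) (z i v))))
      (sqrt (onorm (\<lambda>v. \<Sum>i\<in>I. z i (adj (z i) v)))) \<le> 1"
    by simp
  moreover have "onorm (\<lambda>v. \<Sum>i\<in>I. z i (y i v)) \<le>
      max (sqrt (onorm (\<lambda>v. \<Sum>i\<in>I. adj (z i) (z i v))))
      (sqrt (onorm (\<lambda>v. \<Sum>i\<in>I. z i (adj (z i) v))))"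
    using bound zM unfolding I_def by blast
  ultimately have on: "onorm (\<lambda>v. \<Sum>i\<in>I. z i (y i v)) \<le> 1"
    by (rule order_trans [rotated])
  have "bounded_linear (\<lambda>v. \<Sum>i\<in>I. z i (y i v))"
  proof (rule bounded_linear_sum)
    fix i assume "i \<in> I"
    then have "bop (y i)" using y commutant_bop unfolding I_def by blast
    then show "bounded_linear (\<lambda>v. z i (y i v))"
      using zb by (intro bounded_linear_compose [of "z i" "y i"] bop_bounded_linear)
  qed
  note zyo = onorm [OF this]
  have zy: "norm (\<Sum>i\<in>I. z i (y i v)) \<le> norm v" for v
  proof -
    have "norm (\<Sum>i\<in>I. z i (y i v)) \<le> onorm (\<lambda>v. \<Sum>i\<in>I. z i (y i v)) * norm v" by (rule zyo)
    also have "\<dots> \<le> 1 * norm v" by (rule mult_right_mono [OF on norm_ge_zero])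
    finally show ?thesis by (simp only: mult_1)
  qed
  have "rip \<xi> (X i (y i \<xi>)) = rip (k' \<xi>) (z i (y i (k \<xi>)))" if "i \<in> I" for i
  proof -
    have "y i (k \<xi>) = k (y i \<xi>)"
      using commutant_commute [OF _ k(1)] y that by (auto simp: I_def)
    then show ?thesis by (simp add: z_def k(7) k'(3,6))
  qed
  then have "2 * rip \<xi> (\<Sum>i\<in>I. X i (y i \<xi>)) = 2 * rip (k' \<xi>) (\<Sum>i\<in>I. z i (y i (k \<xi>)))"
    by (simp add: rip.sum_right)
  also have "\<dots> \<le> rip (k' \<xi>) (k' \<xi>) + rip (\<Sum>i\<in>I. z i (y i (k \<xi>))) (\<Sum>i\<in>I. z i (y i (k \<xi>)))"
    by (rule two_rip_le)
  also have "\<dots> \<le> rip (k' \<xi>) (k' \<xi>) + rip (k \<xi>) (k \<xi>)"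
    using zy [of "k \<xi>"] by (simp add: norm_le_iff_rip)
  also have "\<dots> = rip \<xi> (L' \<xi>) + rip \<xi> (L \<xi>)"
    by (simp add: k(3,5) k'(3,5))
  also have "\<dots> \<le> rip \<xi> (K \<xi>) + rip \<xi> (K' \<xi>) + e"
    using eps(2) by (simp add: Lx)
  finally show "2 * rip \<xi> (\<Sum>i=1..n. X i (y i \<xi>)) \<le> rip \<xi> (K \<xi>) + rip \<xi> (K' \<xi>) + e"
    by (simp add: I_def)
qed

text \<open>The functional \<open>G\<close> is \<open>X \<mapsto> rip \<xi> (\<Sum>i. a i (X i \<xi>))\<close> for the summand \<open>a\<close> of the
  decomposition still to be found.\<close>

lemma separating_functional:
  fixes y :: "nat \<Rightarrow> 'a \<Rightarrow> 'a"
  assumes y: "\<forall>i\<in>{1..n}. y i \<in> commutant M"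
    and bound: "\<forall>x :: nat \<Rightarrow> 'a \<Rightarrow> 'a. (\<forall>i\<in>{1..n}. x i \<in> M) \<longrightarrow>
        onorm (\<lambda>v. \<Sum>i=1..n. x i (y i v))
          \<le> max (sqrt (onorm (\<lambda>v. \<Sum>i=1..n. adj (x i) (x i v))))
                 (sqrt (onorm (\<lambda>v. \<Sum>i=1..n. x i (adj (x i) v))))"
  defines "S \<equiv> {X :: nat \<Rightarrow> 'a \<Rightarrow> 'a. \<forall>i. X i \<in> M \<and> (i \<notin> {1..n} \<longrightarrow> X i = 0)}"
  obtains G where
    "\<And>X Y. X \<in> S \<Longrightarrow> Y \<in> S \<Longrightarrow> G (X + Y) = G X + G Y"
    "\<And>r X. X \<in> S \<Longrightarrow> G (r *\<^sub>R X) = r * G X"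
    "\<And>x m. x \<in> S \<Longrightarrow> m \<in> M \<Longrightarrow>
      2 * G (\<lambda>i. adj m \<circ> x i) \<le> (\<Sum>i=1..n. rip (x i \<xi>) (x i \<xi>)) + rip (m \<xi>) (m \<xi>)"
    "\<And>x m. x \<in> S \<Longrightarrow> m \<in> M \<Longrightarrow>
      2 * ((\<Sum>i=1..n. rip (x i \<xi>) (y i (m \<xi>))) - G (\<lambda>i. adj (x i) \<circ> m))
        \<le> (\<Sum>i=1..n. rip (x i \<xi>) (x i \<xi>)) + rip (m \<xi>) (m \<xi>)"
proof -
  define f where "f X = rip \<xi> (\<Sum>i=1..n. X i (y i \<xi>))" for X :: "nat \<Rightarrow> 'a \<Rightarrow> 'a"
  define val where "val K K' X = (rip \<xi> (K \<xi>) + rip \<xi> (K' \<xi>)) / 2 - f X" for K K' X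
  define ok where "ok X Y K K' \<longleftrightarrow> X \<in> S \<and> Y \<in> S \<and> K \<in> M \<and> psd K \<and> K' \<in> M \<and> psd K' \<and>
    col_dom {1..n} K K' X \<and> row_dom {1..n} K K' Y" for X Y K K'
  define E where "E = {(X - Y, val K K' Y) | X Y K K'. ok X Y K K'}"
  have subS: "subspace S"
    by (auto simp: subspace_def S_def M_zero M_plus M_scaleR)
  have S_l: "(\<lambda>i. c \<circ> X i) \<in> S" if "X \<in> S" "c \<in> M" for X c
    using that M_bop [OF that(2)] by (auto simp: S_def M_comp fun_eq_iff bop_zero)
  have S_r: "(\<lambda>i. adj (X i) \<circ> c) \<in> S" if "X \<in> S" "c \<in> M" for X c
    using that by (auto simp: S_def M_comp M_adj adj_zero)
  have bS: "bop (X i)" if "X \<in> S" for X i using that M_bop by (auto simp: S_def)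
  have f_add: "f (X + Y) = f X + f Y" for X Y
    by (simp add: f_def sum.distrib rip.add_right)
  have f_scale: "f (r *\<^sub>R X) = r * f X" for r X
    by (simp add: f_def rip.scaleR_right flip: scaleR_sum_right)
  have gram: "(\<lambda>v. \<Sum>i=1..n. adj (x i) (x i v)) \<in> M" if "x \<in> S" for x
  proof -
    have "(\<lambda>v. \<Sum>i=1..n. (adj (x i) \<circ> x i) v) \<in> M"
      using that by (intro M_sum M_comp M_adj) (auto simp: S_def)
    then show ?thesis by simp
  qed
  have okcol: "ok (\<lambda>i. adj m \<circ> x i) 0 (\<lambda>v. \<Sum>i=1..n. adj (x i) (x i v)) (adj m \<circ> m)"
    if "x \<in> S" "m \<in> M" for x m
    using that unfolding ok_def
    by (intro conjI S_l M_adj subspace_0 [OF subS] gram psd_gram psd_adj_comp M_comp col_dom_gram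
        row_dom_zero bS M_bop)
  have okrow: "ok 0 (\<lambda>i. adj (x i) \<circ> m) (adj m \<circ> m) (\<lambda>v. \<Sum>i=1..n. adj (x i) (x i v))"
    if "x \<in> S" "m \<in> M" for x m
    using that unfolding ok_def
    by (intro conjI S_r M_adj subspace_0 [OF subS] gram psd_gram psd_adj_comp M_comp row_dom_gram
        col_dom_zero bS M_bop)
  have valeq: "rip \<xi> (\<Sum>i=1..n. adj (x i) (x i \<xi>)) = (\<Sum>i=1..n. rip (x i \<xi>) (x i \<xi>))"
    "rip \<xi> ((adj m \<circ> m) \<xi>) = rip (m \<xi>) (m \<xi>)" if "x \<in> S" "m \<in> M" for x m
    using bS [OF that(1)] M_bop [OF that(2)] by (simp_all add: rip_gram flip: rip_adj)
  obtain G where G: "\<And>X Y. X \<in> S \<Longrightarrow> Y \<in> S \<Longrightarrow> G (X + Y) = G X + G Y"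
    "\<And>r X. X \<in> S \<Longrightarrow> G (r *\<^sub>R X) = r * G X"
    "\<And>X r. X \<in> S \<Longrightarrow> (X, r) \<in> E \<Longrightarrow> G X \<le> r"
  proof (rule cone_Hahn_Banach [of E S])
    have "ok 0 0 0 0"
      by (simp add: ok_def subspace_0 [OF subS] M_zero psd_zero col_dom_zero row_dom_zero)
    moreover have "val 0 0 0 = 0" by (simp add: val_def f_def rip.zero_right)
    ultimately show "0 \<in> E" unfolding E_def zero_prod_def by force
    show "p + q \<in> E" if pE: "p \<in> E" and qE: "q \<in> E" for p q
    proof -
      obtain X Y K K' where 1: "p = (X - Y, val K K' Y)" "ok X Y K K'" using pE E_def by blast
      obtain U V L L' where 2: "q = (U - V, val L L' V)" "ok U V L L'" using qE E_def by blast
      have "ok (X + U) (Y + V) (K + L) (K' + L')"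
        using 1(2) 2(2) subS unfolding ok_def
        by (simp add: subspace_add M_plus psd_plus col_dom_plus row_dom_plus)
      moreover have "p + q = ((X + U) - (Y + V), val (K + L) (K' + L') (Y + V))"
        unfolding 1 2 by (simp add: val_def f_add rip.add_right field_simps)
      ultimately show ?thesis unfolding E_def by blast
    qed
    show "c *\<^sub>R p \<in> E" if c: "c > 0" and pE: "p \<in> E" for c p
    proof -
      obtain X Y K K' where 1: "p = (X - Y, val K K' Y)" "ok X Y K K'" using pE E_def by blast
      have "ok (c *\<^sub>R X) (c *\<^sub>R Y) (c *\<^sub>R K) (c *\<^sub>R K')"
        using 1(2) subS c unfolding ok_def
        by (simp add: subspace_scale M_scaleR psd_scaleR col_dom_scaleR row_dom_scaleR)
      moreover have "c *\<^sub>R p = (c *\<^sub>R X - c *\<^sub>R Y, val (c *\<^sub>R K) (c *\<^sub>R K') (c *\<^sub>R Y))"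
        unfolding 1 by (simp add: val_def f_scale rip.scaleR_right scaleR_diff_right algebra_simps add_divide_distrib)
      ultimately show ?thesis unfolding E_def by blast
    qed
    show "0 \<le> r" if rE: "(0, r) \<in> E" for r
    proof -
      obtain X Y K K' where 1: "(0, r) = (X - Y, val K K' Y)" "ok X Y K K'" using rE E_def by blast
      then have XY: "X = Y" "r = val K K' Y" by auto
      have "2 * f Y \<le> rip \<xi> (K \<xi>) + rip \<xi> (K' \<xi>)"
        using 1(2) unfolding ok_def XY f_def
        by (intro dominated_row_column_bound [OF y bound]) (auto simp: S_def)
      then show ?thesis by (simp add: XY val_def)
    qed
    show "\<exists>r. (X, r) \<in> E" if "X \<in> S" for X
    proof -
      have "adj id = (id :: 'a \<Rightarrow> 'a)" by (rule adj_unique) (simp_all add: bop_id)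
      then have "ok X 0 (\<lambda>v. \<Sum>i=1..n. adj (X i) (X i v)) (id \<circ> id)"
        using okcol [OF that M_id] by simp
      then have "(X - 0, val (\<lambda>v. \<Sum>i=1..n. adj (X i) (X i v)) (id \<circ> id) 0) \<in> E"
        unfolding E_def by blast
      then show ?thesis by auto
    qed
    show "subspace S" by (rule subS)
  qed blast
  have f0: "f 0 = 0" by (simp add: f_def rip.zero_right)
  have c: "2 * G (\<lambda>i. adj m \<circ> x i) \<le> (\<Sum>i=1..n. rip (x i \<xi>) (x i \<xi>)) + rip (m \<xi>) (m \<xi>)"
    if x: "x \<in> S" and m: "m \<in> M" for x m
  proof -
    have "((\<lambda>i. adj m \<circ> x i) - 0, val (\<lambda>v. \<Sum>i=1..n. adj (x i) (x i v)) (adj m \<circ> m) 0) \<in> E"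
      using okcol [OF x m] unfolding E_def by blast
    then have "G (\<lambda>i. adj m \<circ> x i) \<le> val (\<lambda>v. \<Sum>i=1..n. adj (x i) (x i v)) (adj m \<circ> m) 0"
      using G(3) S_l [OF x M_adj [OF m]] by simp
    then show ?thesis unfolding val_def valeq [OF x m] f0 by simp
  qed
  have r: "2 * ((\<Sum>i=1..n. rip (x i \<xi>) (y i (m \<xi>))) - G (\<lambda>i. adj (x i) \<circ> m))
        \<le> (\<Sum>i=1..n. rip (x i \<xi>) (x i \<xi>)) + rip (m \<xi>) (m \<xi>)"
    if x: "x \<in> S" and m: "m \<in> M" for x m
  proof -
    define Y where "Y = (\<lambda>i. adj (x i) \<circ> m)"
    have YS: "Y \<in> S" unfolding Y_def by (rule S_r [OF x m])
    have "(0 - Y, val (adj m \<circ> m) (\<lambda>v. \<Sum>i=1..n. adj (x i) (x i v)) Y) \<in> E"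
      using okrow [OF x m] unfolding E_def Y_def by blast
    then have "G ((-1) *\<^sub>R Y) \<le> val (adj m \<circ> m) (\<lambda>v. \<Sum>i=1..n. adj (x i) (x i v)) Y"
      using subspace_scale [OF subS YS, of "-1"] by (intro G(3)) auto
    then have "- G Y \<le> val (adj m \<circ> m) (\<lambda>v. \<Sum>i=1..n. adj (x i) (x i v)) Y"
      using G(2) [OF YS, of "-1"] by simp
    moreover have "f Y = (\<Sum>i=1..n. rip (x i \<xi>) (y i (m \<xi>)))"
    proof -
      have "rip \<xi> (Y i (y i \<xi>)) = rip (x i \<xi>) (y i (m \<xi>))" if i: "i \<in> {1..n}" for i
        using commutant_commute [OF _ m, of "y i" \<xi>] y i bS [OF x]
        by (simp add: Y_def flip: rip_adj)
      then show ?thesis by (simp add: f_def rip.sum_right)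
    qed
    ultimately show ?thesis unfolding val_def valeq [OF x m] Y_def by (simp add: field_simps)
  qed
  show ?thesis by (rule that [OF G(1,2) c r])
qed

lemma decomposition:
  fixes y :: "nat \<Rightarrow> 'a \<Rightarrow> 'a"
  assumes y: "\<forall>i\<in>{1..n}. y i \<in> commutant M"
    and bound: "\<forall>x :: nat \<Rightarrow> 'a \<Rightarrow> 'a. (\<forall>i\<in>{1..n}. x i \<in> M) \<longrightarrow>
        onorm (\<lambda>v. \<Sum>i=1..n. x i (y i v))
          \<le> max (sqrt (onorm (\<lambda>v. \<Sum>i=1..n. adj (x i) (x i v))))
                 (sqrt (onorm (\<lambda>v. \<Sum>i=1..n. x i (adj (x i) v))))"
  shows "\<exists>a b :: nat \<Rightarrow> 'a \<Rightarrow> 'a.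
           (\<forall>i\<in>{1..n}. a i \<in> commutant M \<and> b i \<in> commutant M \<and> y i = (\<lambda>v. a i v + b i v)) \<and>
           onorm (\<lambda>v. \<Sum>i=1..n. a i (adj (a i) v)) \<le> 1 \<and>
           onorm (\<lambda>v. \<Sum>i=1..n. adj (b i) (b i v)) \<le> 1"
proof -
  define I where "I = {1..n}"
  define S where "S = {X :: nat \<Rightarrow> 'a \<Rightarrow> 'a. \<forall>i. X i \<in> M \<and> (i \<notin> I \<longrightarrow> X i = 0)}"
  obtain G where G_add: "\<And>X Y. X \<in> S \<Longrightarrow> Y \<in> S \<Longrightarrow> G (X + Y) = G X + G Y"
    and G_scale: "\<And>r X. X \<in> S \<Longrightarrow> G (r *\<^sub>R X) = r * G X"
    and G_col: "\<And>x m. x \<in> S \<Longrightarrow> m \<in> M \<Longrightarrow>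
      2 * G (\<lambda>i. adj m \<circ> x i) \<le> (\<Sum>i\<in>I. rip (x i \<xi>) (x i \<xi>)) + rip (m \<xi>) (m \<xi>)"
    and G_row: "\<And>x m. x \<in> S \<Longrightarrow> m \<in> M \<Longrightarrow>
      2 * ((\<Sum>i\<in>I. rip (x i \<xi>) (y i (m \<xi>))) - G (\<lambda>i. adj (x i) \<circ> m))
        \<le> (\<Sum>i\<in>I. rip (x i \<xi>) (x i \<xi>)) + rip (m \<xi>) (m \<xi>)"
    using separating_functional [OF y bound] unfolding S_def I_def by blast
  have subS: "subspace S"
    by (auto simp: subspace_def S_def M_zero M_plus M_scaleR)
  define \<delta> where "\<delta> i T = (\<lambda>j. if j = i then T else 0)" for i :: nat and T :: "'a \<Rightarrow> 'a"
  have dS: "\<delta> i T \<in> S" if "i \<in> I" "T \<in> M" for i T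
    using that by (auto simp: S_def \<delta>_def M_zero)
  have G0: "G 0 = 0" using G_scale [OF subspace_0 [OF subS], of 0] by simp
  have G_sum: "G (\<Sum>i\<in>J. g i) = (\<Sum>i\<in>J. G (g i))" if "\<And>i. i \<in> J \<Longrightarrow> g i \<in> S" for J :: "nat set" and g
    using that
  proof (induction J rule: infinite_finite_induct)
    case (insert i J)
    have "G (\<Sum>i\<in>insert i J. g i) = G (g i + (\<Sum>i\<in>J. g i))"
      by (simp only: sum.insert [OF insert(1,2)])
    also have "\<dots> = G (g i) + G (\<Sum>i\<in>J. g i)"
      by (intro G_add subspace_sum [OF subS] insert(4)) auto
    also have "G (\<Sum>i\<in>J. g i) = (\<Sum>i\<in>J. G (g i))"
      using insert(4) by (intro insert(3)) auto
    finally show ?case by (simp only: sum.insert [OF insert(1,2)])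
  qed (simp_all add: G0)
  have G_decomp: "G X = (\<Sum>i\<in>I. G (\<delta> i (X i)))" if X: "X \<in> S" for X
  proof -
    have "(\<Sum>i\<in>J. \<delta> i (X i)) j = (if j \<in> J then X j else 0)" if "finite J" for J j
      using that by (induction J) (auto simp: \<delta>_def)
    then have "X = (\<Sum>i\<in>I. \<delta> i (X i))"
      using X by (auto simp: fun_eq_iff S_def I_def)
    then have "G X = G (\<Sum>i\<in>I. \<delta> i (X i))" by simp
    also have "\<dots> = (\<Sum>i\<in>I. G (\<delta> i (X i)))"
      by (rule G_sum) (use X dS in \<open>auto simp: S_def\<close>)
    finally show ?thesis .
  qed
  have d_add: "\<delta> i (T + U) = \<delta> i T + \<delta> i U" and d_scale: "\<delta> i (r *\<^sub>R T) = r *\<^sub>R \<delta> i T" for i T U r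
    by (auto simp: \<delta>_def fun_eq_iff)
  have "\<exists>T. T \<in> commutant M \<and>
      (\<forall>m\<in>M. \<forall>x\<in>M. G (\<delta> i (adj m \<circ> x)) = rip (m \<xi>) (T (x \<xi>)))" if i: "i \<in> I" for i
  proof -
    have d: "\<delta> i (adj m \<circ> x) \<in> S" if "m \<in> M" "x \<in> M" for m x
      by (intro dS i M_comp M_adj that)
    have scale_l: "G (\<delta> i (adj (r *\<^sub>R m) \<circ> x)) = r * G (\<delta> i (adj m \<circ> x))" if m: "m \<in> M" "x \<in> M" for r m x
    proof -
      have "adj (r *\<^sub>R m) \<circ> x = r *\<^sub>R (adj m \<circ> x)"
        using adj_scaleR [OF M_bop [OF m(1)]] by (auto simp: fun_eq_iff)
      then show ?thesis using G_scale [OF d [OF m]] by (simp add: d_scale)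
    qed
    obtain T where "T \<in> commutant M"
      "\<And>m x. m \<in> M \<Longrightarrow> x \<in> M \<Longrightarrow> G (\<delta> i (adj m \<circ> x)) = rip (m \<xi>) (T (x \<xi>))"
    proof (rule form_representation [of "\<lambda>m x. G (\<delta> i (adj m \<circ> x))"])
      fix m x assume m: "m \<in> M" and x: "x \<in> M"
      have bm: "bop m" "bop (adj m)" using m M_bop bop_adj by blast+
      show "G (\<delta> i (adj (r *\<^sub>R m) \<circ> x)) = r * G (\<delta> i (adj m \<circ> x))" for r
        using scale_l m x by blast
      show "G (\<delta> i (adj m \<circ> r *\<^sub>R x)) = r * G (\<delta> i (adj m \<circ> x))" for r
      proof -
        have "adj m \<circ> r *\<^sub>R x = r *\<^sub>R (adj m \<circ> x)"
          using bm by (auto simp: fun_eq_iff bop_scaleR)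
        then show ?thesis using G_scale [OF d [OF m x]] by (simp add: d_scale)
      qed
      show "G (\<delta> i (adj m \<circ> (x + x'))) = G (\<delta> i (adj m \<circ> x)) + G (\<delta> i (adj m \<circ> x'))" if x': "x' \<in> M" for x'
      proof -
        have "adj m \<circ> (x + x') = (adj m \<circ> x) + (adj m \<circ> x')"
          using bm by (auto simp: fun_eq_iff bop_add)
        then show ?thesis using G_add [OF d [OF m x] d [OF m x']] by (simp add: d_add)
      qed
      show "G (\<delta> i (adj (m + m') \<circ> x)) = G (\<delta> i (adj m \<circ> x)) + G (\<delta> i (adj m' \<circ> x))" if m': "m' \<in> M" for m'
      proof -
        have "adj (m + m') \<circ> x = (adj m \<circ> x) + (adj m' \<circ> x)"
          using adj_plus [OF bm(1) M_bop [OF m']] by (auto simp: fun_eq_iff)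
        then show ?thesis using G_add [OF d [OF m x] d [OF m' x]] by (simp add: d_add)
      qed
      show "G (\<delta> i (adj m \<circ> (c \<circ> x))) = G (\<delta> i (adj (adj c \<circ> m) \<circ> x))" if c: "c \<in> M" for c
      proof -
        have "adj (adj c \<circ> m) = adj m \<circ> c"
          using c m by (simp add: adj_comp adj_adj M_bop bop_adj)
        then show ?thesis by (simp add: comp_assoc)
      qed
      show "\<bar>G (\<delta> i (adj m \<circ> x))\<bar> \<le> norm (m \<xi>) * norm (x \<xi>)"
      proof -
        have q: "2 * G (\<delta> i (adj m' \<circ> x)) \<le> rip (x \<xi>) (x \<xi>) + rip (m' \<xi>) (m' \<xi>)" if m': "m' \<in> M" for m'
        proof -
          have "adj m' \<circ> 0 = 0"
            using bop_adj [OF M_bop [OF m']] by (auto simp: fun_eq_iff bop_zero)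
          then have "\<delta> i (adj m' \<circ> x) = (\<lambda>j. adj m' \<circ> \<delta> i x j)"
            by (auto simp: \<delta>_def)
          moreover have "(\<Sum>j\<in>I. rip (\<delta> i x j \<xi>) (\<delta> i x j \<xi>)) = (\<Sum>j\<in>I. if j = i then rip (x \<xi>) (x \<xi>) else 0)"
            by (intro sum.cong) (auto simp: \<delta>_def rip.zero_left)
          then have "(\<Sum>j\<in>I. rip (\<delta> i x j \<xi>) (\<delta> i x j \<xi>)) = rip (x \<xi>) (x \<xi>)"
            using i by (simp add: I_def)
          ultimately show ?thesis using G_col [OF dS [OF i x] m'] by simp
        qed
        have "\<bar>G (\<delta> i (adj m \<circ> x))\<bar> \<le> norm (x \<xi>) * norm (m \<xi>)"
        proof (rule abs_le_mult_of_quadratic)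
          show "2 * (s * G (\<delta> i (adj m \<circ> x))) \<le> (norm (x \<xi>))\<^sup>2 + s\<^sup>2 * (norm (m \<xi>))\<^sup>2" for s
            using q [OF M_scaleR [OF m, of s]]
            by (simp add: scale_l [OF m x] rip.scaleR_left rip.scaleR_right power2_norm_eq_rip power2_eq_square [of s] mult_ac)
        qed auto
        then show ?thesis by (simp add: mult.commute)
      qed
    qed blast
    then show ?thesis by blast
  qed
  then obtain a where a: "\<And>i. i \<in> I \<Longrightarrow> a i \<in> commutant M"
    and aG: "\<And>i m x. i \<in> I \<Longrightarrow> m \<in> M \<Longrightarrow> x \<in> M \<Longrightarrow> G (\<delta> i (adj m \<circ> x)) = rip (m \<xi>) (a i (x \<xi>))"
    by metis
  define b where "b i = y i + (-1) *\<^sub>R a i" for i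
  have b: "b i \<in> commutant M" if "i \<in> I" for i
    unfolding b_def using y a that
    by (intro commutant_plus commutant_scaleR M_subset_bop) (auto simp: I_def)
  have restrict: "(\<lambda>i. if i \<in> I then x i else 0) \<in> S" if "\<And>i. x i \<in> M" for x
    using that by (auto simp: S_def M_zero)
  have "onorm (\<lambda>v. \<Sum>i\<in>I. a i (adj (a i) v)) \<le> 1"
  proof (rule onorm_row_le_1 [OF a])
    fix x :: "nat \<Rightarrow> 'a \<Rightarrow> 'a" and m assume x: "\<And>i. x i \<in> M" and m: "m \<in> M"
    define u where "u i = (if i \<in> I then x i else 0)" for i
    have uS: "u \<in> S" unfolding u_def using restrict x by blast
    have "adj m \<circ> 0 = 0"
      using bop_adj [OF M_bop [OF m]] by (auto simp: fun_eq_iff bop_zero)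
    then have "(\<lambda>i. adj m \<circ> u i) \<in> S"
      using x M_adj [OF m] by (auto simp: S_def u_def M_comp M_zero)
    then have "G (\<lambda>i. adj m \<circ> u i) = (\<Sum>i\<in>I. G (\<delta> i (adj m \<circ> u i)))"
      by (rule G_decomp)
    also have "\<dots> = rip (m \<xi>) (\<Sum>i\<in>I. a i (x i \<xi>))"
      using aG [OF _ m x] by (simp add: u_def rip.sum_right)
    finally show "2 * rip (m \<xi>) (\<Sum>i\<in>I. a i (x i \<xi>)) \<le> (\<Sum>i\<in>I. rip (x i \<xi>) (x i \<xi>)) + rip (m \<xi>) (m \<xi>)"
      using G_col [OF uS m] by (simp add: u_def)
  qed
  moreover have "onorm (\<lambda>v. \<Sum>i\<in>I. adj (b i) (adj (adj (b i)) v)) \<le> 1"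
  proof (rule onorm_row_le_1 [OF commutant_adj [OF b]])
    fix x :: "nat \<Rightarrow> 'a \<Rightarrow> 'a" and m assume x: "\<And>i. x i \<in> M" and m: "m \<in> M"
    define u where "u i = (if i \<in> I then x i else 0)" for i
    have uS: "u \<in> S" unfolding u_def using restrict x by blast
    have "(\<lambda>i. adj (u i) \<circ> m) \<in> S"
      using x m by (auto simp: S_def u_def M_comp M_zero M_adj adj_zero)
    then have "G (\<lambda>i. adj (u i) \<circ> m) = (\<Sum>i\<in>I. G (\<delta> i (adj (u i) \<circ> m)))"
      by (rule G_decomp)
    also have "\<dots> = (\<Sum>i\<in>I. rip (x i \<xi>) (a i (m \<xi>)))"
      using aG [OF _ x m] by (simp add: u_def)
    finally have "2 * ((\<Sum>i\<in>I. rip (x i \<xi>) (y i (m \<xi>))) - (\<Sum>i\<in>I. rip (x i \<xi>) (a i (m \<xi>))))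
        \<le> (\<Sum>i\<in>I. rip (x i \<xi>) (x i \<xi>)) + rip (m \<xi>) (m \<xi>)"
      using G_row [OF uS m] by (simp add: u_def)
    moreover have "rip (m \<xi>) (\<Sum>i\<in>I. adj (b i) (x i \<xi>)) = (\<Sum>i\<in>I. rip (x i \<xi>) (b i (m \<xi>)))"
      using commutant_bop [OF b] by (simp add: rip.sum_right rip_commute [of "m \<xi>"] rip_adj_left)
    moreover have "\<dots> = (\<Sum>i\<in>I. rip (x i \<xi>) (y i (m \<xi>))) - (\<Sum>i\<in>I. rip (x i \<xi>) (a i (m \<xi>)))"
      by (simp add: b_def rip.diff_right sum_subtractf)
    ultimately show "2 * rip (m \<xi>) (\<Sum>i\<in>I. adj (b i) (x i \<xi>))
        \<le> (\<Sum>i\<in>I. rip (x i \<xi>) (x i \<xi>)) + rip (m \<xi>) (m \<xi>)" by simp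
  qed
  then have "onorm (\<lambda>v. \<Sum>i\<in>I. adj (b i) (b i v)) \<le> 1"
    by (simp add: adj_adj [OF commutant_bop [OF b]] cong: sum.cong)
  moreover have "y i = (\<lambda>v. a i v + b i v)" for i
    by (auto simp: b_def)
  ultimately show ?thesis using a b unfolding I_def by blast
qed

end

theorem theorem4:
  fixes M :: "('a::complex_hilbert \<Rightarrow> 'a) set"
    and y :: "nat \<Rightarrow> 'a \<Rightarrow> 'a"
    and n :: nat
  assumes vN: "von_neumann_algebra M"
    and cyc: "\<exists>\<xi>. cyclic_vector M \<xi>"
    and y_comm: "\<forall>i\<in>{1..n}. y i \<in> commutant M"
    and bound: "\<forall>x :: nat \<Rightarrow> 'a \<Rightarrow> 'a. (\<forall>i\<in>{1..n}. x i \<in> M) \<longrightarrow>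
        onorm (\<lambda>v. \<Sum>i=1..n. x i (y i v))
          \<le> max (sqrt (onorm (\<lambda>v. \<Sum>i=1..n. adj (x i) (x i v))))
                 (sqrt (onorm (\<lambda>v. \<Sum>i=1..n. x i (adj (x i) v))))"
  shows "\<exists>a b :: nat \<Rightarrow> 'a \<Rightarrow> 'a.
           (\<forall>i\<in>{1..n}. a i \<in> commutant M \<and> b i \<in> commutant M \<and> y i = (\<lambda>v. a i v + b i v)) \<and>
           onorm (\<lambda>v. \<Sum>i=1..n. a i (adj (a i) v)) \<le> 1 \<and>
           onorm (\<lambda>v. \<Sum>i=1..n. adj (b i) (b i v)) \<le> 1"
proof -
  obtain \<xi> where "cyclic_vector M \<xi>" using cyc by blast
  then interpret cyclic_vN_algebra M \<xi> using vN by unfold_locales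
  show ?thesis using y_comm bound by (rule decomposition)
qed

end
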